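(* Let $g_E = h_E^4(t)\, g_o = \bigl(1+E H(t)+E^2 G(t)+\mathcal{O}(E^3)\bigr) g_o$ be a deformation of the flat metric $g_o = dt^2+dy^2$ on the torus $T^2$ such that $h_E^4(t)=h_E^4(1-t)$ for all $t$ and all $E$. Let $\mu_1(E),\mu_2(E),\mu_3(E)$ and $\lambda_1^2(E),\lambda_2^2(E),\lambda_3^2(E)$ be the spectral functions of the Laplace operator and of the square of the Dirac operator of $g_E$ described in the context. Suppose that for $E\neq 0$ the numbers $\mu_1(E)\neq\mu_2(E)$ are simple eigenvalues of the periodic problem $-A''(t)=\mu\, h_E^4(t)A(t)$ (the case $k=0$). Then, with the dot denoting the derivative with respect to $E$: (a) $\dot\mu_1(0) = -8\pi^2\int_0^1 H(t)\sin^2(2\pi t)\,dt$, $\quad \dot\mu_2(0) = -8\pi^2\int_0^1 H(t)\cos^2(2\pi t)\,dt$, $\quad \dot\mu_3(0) = -4\pi^2\int_0^1 H(t)\,dt$. (b) $\dot{(\lambda_1^2)}(0)=\dot{(\lambda_2^2)}(0)=\dot{(\lambda_3^2)}(0) = -4\pi^2\int_0^1 H(t)\,dt$. In particular, $\dot\mu_1(0)+\dot\mu_2(0)=2\dot\mu_3(0)=2\dot{(\lambda_\alpha^2)}(0)$ for $\alpha=1,2,3$.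
   Context: $T^2=\mathbb{R}^2/\mathbb{Z}^2$ with coordinates $0\le t\le 1$, $0\le y\le 1$ and the trivial spin structure. A deformation of the flat metric means a family $g_E=h_E^4(t)g_o$, where $h_E$ is a positive $1$-periodic function depending smoothly on $(E,t)$, for $E$ in an interval around $0$, with $h_0\equiv 1$. Derivatives in $t$ are denoted by $'$. Functions of the form $A(t)e^{2\pi i k y}$, $k\in\mathbb{Z}$, are eigenfunctions of the (positive) Laplace operator $\Delta_{g_E}$ with eigenvalue $\mu$ iff $A$ is a $1$-periodic nontrivial solution of $$-A''(t)=\{\mu\,h_E^4(t)-4\pi^2k^2\}A(t).$$ Sections of the positive half-spinor bundle $S^+$ of weight $l\in\mathbb{Z}$ under the isometric $S^1$-action in the $y$-variable are given by functions $A(t)e^{2\pi i l y}$, and they are eigenspinors of $D_{g_E}^2$ with eigenvalue $\lambda^2$ iff $A$ is a $1$-periodic nontrivial solution of $$-A''(t)=\Bigl\{\lambda^2 h_E^4(t)+\frac{h_E(t)h_E''(t)-2(h_E'(t))^2}{h_E^2(t)}-4\pi^2l^2+4\pi l\,\frac{h_E'(t)}{h_E(t)}\Bigr\}A(t).$$ At $E=0$ the first positive eigenvalue of each of $\Delta_{g_o}$ and $D_{g_o}^2|_{S^+}$ is $4\pi^2$, of multiplicity four. The spectral functions are the branches (smooth in $E$, with smooth families of eigenfunctions) with value $4\pi^2$ at $E=0$: - $\mu_1(E)$ and $\mu_2(E)$: eigenvalues of the Laplace problem with $k=0$ whose eigenfunctions are deformations of $\sin(2\pi t)$ and $\cos(2\pi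 t)$, respectively; - $\mu_3(E)$: the eigenvalue of the Laplace problem with $k=\pm1$ whose eigenfunction is a deformation of the constant function $1$; - $\lambda_1^2(E)$: the eigenvalue (of multiplicity two) of the Dirac problem with $l=0$; - $\lambda_2^2(E),\lambda_3^2(E)$: the eigenvalues of the Dirac problem with $l=-1$ and $l=1$, respectively, whose eigenfunctions are deformations of the constant function $1$. *)

theory Defs
  imports "HOL-Analysis.Analysis" "HOL-Library.Function_Algebras" "HOL-Library.Landau_Symbols"
begin

text \<open>On an open set this is the usual notion of a \<open>C\<^sup>k\<close> function: all iterated directional derivatives
  up to order \<open>k\<close> exist and are continuous.\<close>

fun Ck_on :: "nat \<Rightarrow> 'a::real_normed_vector set \<Rightarrow> ('a \<Rightarrow> 'b::real_normed_vector) \<Rightarrow> bool" where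
  "Ck_on 0 S f \<longleftrightarrow> continuous_on S f"
| "Ck_on (Suc k) S f \<longleftrightarrow>
     (\<forall>x\<in>S. f differentiable (at x)) \<and> (\<forall>v. Ck_on k S (\<lambda>x. frechet_derivative f (at x) v))"

definition smooth_on :: "'a::real_normed_vector set \<Rightarrow> ('a \<Rightarrow> 'b::real_normed_vector) \<Rightarrow> bool" where
  "smooth_on S f \<longleftrightarrow> (\<forall>k. Ck_on k S f)"

text \<open>A deformation of the flat metric \<open>dt\<^sup>2 + dy\<^sup>2\<close> on the torus is given by the conformal
  factors \<open>h E\<close>; the metric with parameter \<open>E\<close> is \<open>(h E t)\<^sup>4 (dt\<^sup>2 + dy\<^sup>2)\<close>.\<close>

definition flat_deformation :: "real set \<Rightarrow> (real \<Rightarrow> real \<Rightarrow> real) \<Rightarrow> bool" where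
  "flat_deformation I h \<longleftrightarrow>
     open I \<and> is_interval I \<and> 0 \<in> I \<and>
     smooth_on (I \<times> UNIV) (\<lambda>(E, t). h E t) \<and>
     (\<forall>E\<in>I. \<forall>t. h E t > 0 \<and> h E (t + 1) = h E t) \<and>
     (\<forall>t. h 0 t = 1)"

text \<open>The complex vector space of 1-periodic solutions of \<open>- A'' = q A\<close>.\<close>

definition periodic_solutions :: "(real \<Rightarrow> real) \<Rightarrow> (real \<Rightarrow> complex) set" where
  "periodic_solutions q =
     {A. (\<forall>t. A (t + 1) = A t) \<and>
         (\<exists>A' A''. \<forall>t. (A has_vector_derivative A' t) (at t) \<and>
                       (A' has_vector_derivative A'' t) (at t) \<and>
                       - A'' t = complex_of_real (q t) * A t)}"

lemma vector_space_complex_fun: "vector_space (\<lambda>(c::complex) (A :: real \<Rightarrow> complex) t. c * A t)"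
  by unfold_locales (auto simp: fun_eq_iff algebra_simps)

definition solution_dim :: "(real \<Rightarrow> real) \<Rightarrow> nat" where
  "solution_dim q =
     vector_space.dim (\<lambda>(c::complex) (A :: real \<Rightarrow> complex) t. c * A t) (periodic_solutions q)"

text \<open>The function \<open>A(t) exp(2\<pi>iky)\<close> is an eigenfunction of the positive Laplace operator of
  \<open>u\<^sup>4 (dt\<^sup>2 + dy\<^sup>2)\<close> with eigenvalue \<open>\<mu>\<close> iff \<open>A\<close> is a nontrivial 1-periodic solution of
  \<open>- A'' = laplace_coeff u k \<mu> A\<close>.\<close>

definition laplace_coeff :: "(real \<Rightarrow> real) \<Rightarrow> int \<Rightarrow> real \<Rightarrow> real \<Rightarrow> real" where
  "laplace_coeff u k \<mu> t = \<mu> * u t ^ 4 - 4 * pi\<^sup>2 * (of_int k)\<^sup>2"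

text \<open>The positive half-spinor \<open>A(t) exp(2\<pi>ily)\<close> (trivial spin structure) is an eigenspinor of the
  square of the Dirac operator of \<open>u\<^sup>4 (dt\<^sup>2 + dy\<^sup>2)\<close> with eigenvalue \<open>L\<close> (a squared Dirac eigenvalue)
  iff \<open>A\<close> is a nontrivial 1-periodic solution of \<open>- A'' = dirac_coeff u l L A\<close>.\<close>

definition dirac_coeff :: "(real \<Rightarrow> real) \<Rightarrow> int \<Rightarrow> real \<Rightarrow> real \<Rightarrow> real" where
  "dirac_coeff u l L t =
     L * u t ^ 4 + (u t * deriv (deriv u) t - 2 * (deriv u t)\<^sup>2) / (u t)\<^sup>2
       - 4 * pi\<^sup>2 * (of_int l)\<^sup>2 + 4 * pi * of_int l * (deriv u t / u t)"

text \<open>For each parameter \<open>E\<close> and each candidate eigenvalue \<open>x\<close>, \<open>Q E x\<close> is the coefficient of the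
  equation. The branch \<open>\<nu>\<close> starts at \<open>4\<pi>\<^sup>2\<close>, the first positive eigenvalue of the flat torus.\<close>

definition spectral_branch ::
    "real set \<Rightarrow> (real \<Rightarrow> real \<Rightarrow> real \<Rightarrow> real) \<Rightarrow> (real \<Rightarrow> real) \<Rightarrow> (real \<Rightarrow> real \<Rightarrow> complex) \<Rightarrow> bool" where
  "spectral_branch I Q \<nu> A \<longleftrightarrow>
     smooth_on I \<nu> \<and> \<nu> 0 = 4 * pi\<^sup>2 \<and>
     smooth_on (I \<times> UNIV) (\<lambda>(E, t). A E t) \<and>
     (\<forall>E\<in>I. A E \<in> periodic_solutions (Q E (\<nu> E)) \<and> (\<exists>t. A E t \<noteq> 0))"

definition deformation_branch ::
    "real set \<Rightarrow> (real \<Rightarrow> real \<Rightarrow> real \<Rightarrow> real) \<Rightarrow> (real \<Rightarrow> real) \<Rightarrow> (real \<Rightarrow> real) \<Rightarrow> bool" where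
  "deformation_branch I Q \<phi> \<nu> \<longleftrightarrow>
     (\<exists>A. spectral_branch I Q \<nu> A \<and> (\<forall>t. A 0 t = complex_of_real (\<phi> t)))"

end

theory Submission
  imports Defs
begin

text \<open>Pairing the equation for an eigenfunction \<open>a\<^sub>E\<close> with a solution \<open>b\<close> of the flat equation gives
  \<open>\<integral> (Q\<^sub>E - Q\<^sub>0) a\<^sub>E b = 0\<close>; dividing by \<open>E\<close> and letting \<open>E \<rightarrow> 0\<close>, only the first-order variation of
  \<open>Q\<close> tested against \<open>a\<^sub>0 b\<close> survives, and this determines the derivative of the eigenvalue.
  The spin term of the Dirac equation is, up to \<open>O(E\<^sup>2)\<close>, the derivative of a periodic function, so it
  drops out when \<open>a\<^sub>0 b = 1\<close>. For the double eigenvalue all solutions are periodic, and continuous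
  dependence on the coefficient yields solutions near \<open>cos (2\<pi>t)\<close> and \<open>sin (2\<pi>t)\<close>, whose two conditions
  add up to the weight \<open>1\<close>.\<close>

text \<open>The expansion of \<open>h E t ^ 4\<close> is given pointwise in \<open>t\<close>, so
  \<open>H\<close> is known only as a pointwise limit of difference quotients. Uniformity in
  \<open>t\<close> comes from the joint smoothness of \<open>h\<close> in \<open>(E, t)\<close>: it
  bounds \<open>(h E t ^ 4 - 1) / E\<close> on [0, 1], and dominated convergence then yields both
  the limits and the integrability of \<open>H\<close> times a weight. Eigenfunctions are never
  differentiated in \<open>E\<close>: the paired identity is exact for every \<open>E\<close>, so
  uniform convergence to the flat solution is enough. Since all coefficients are real, real parts of
  eigenfunctions suffice. The obstacle is the double eigenvalue: its branch prescribes no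
  eigenfunction at \<open>E = 0\<close>, and against a single weight such as \<open>cos^2\<close>
  the spin term may contribute at first order. The constant weight removes this contribution, and
  obtaining that weight takes two independent solutions.\<close>

definition hill_solution :: "(real \<Rightarrow> real) \<Rightarrow> (real \<Rightarrow> real) \<Rightarrow> (real \<Rightarrow> real) \<Rightarrow> bool" where
  "hill_solution q a a' \<longleftrightarrow>
     (\<forall>t. a (t + 1) = a t) \<and>
     (\<forall>t. (a has_real_derivative a' t) (at t)) \<and>
     (\<forall>t. (a' has_real_derivative - (q t * a t)) (at t))"

section \<open>Periodic functions and Green's identity\<close>

lemma has_real_derivative_periodic:
  fixes f :: "real \<Rightarrow> real"
  assumes "\<And>t. f (t + 1) = f t" "\<And>t. (f has_real_derivative f' t) (at t)"
  shows "f' (t + 1) = f' t"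
proof -
  have "((\<lambda>t. f (t + 1)) has_real_derivative f' (t + 1)) (at t)"
    using assms(2)[of "t + 1"] by (simp add: DERIV_shift)
  then show ?thesis
    using assms(1) assms(2)[of t] DERIV_unique by auto
qed

lemma has_integral_periodic_derivative:
  fixes f :: "real \<Rightarrow> real"
  assumes "\<And>t. f (t + 1) = f t" "\<And>t. (f has_real_derivative f' t) (at t)"
  shows "(f' has_integral 0) {0..1}"
proof -
  have "(f' has_integral (f 1 - f 0)) {0..1}"
    by (rule fundamental_theorem_of_calculus)
       (auto simp: has_real_derivative_iff_has_vector_derivative[symmetric]
             intro: DERIV_subset[OF assms(2)])
  then show ?thesis using assms(1)[of 0] by simp
qed

lemma hill_solution_continuous:
  assumes "hill_solution q a a'"
  shows "continuous_on S a"
  using assms unfolding hill_solution_def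
  by (meson DERIV_isCont continuous_at_imp_continuous_on)

text \<open>Green's identity: the integrand is the derivative of the Wronskian.\<close>

lemma hill_solution_pairing:
  assumes a: "hill_solution p a a'" and b: "hill_solution q b b'"
  shows "((\<lambda>t. (p t - q t) * (a t * b t)) has_integral 0) {0..1}"
proof -
  have da: "(a has_real_derivative a' t) (at t)" "(a' has_real_derivative - (p t * a t)) (at t)"
    and db: "(b has_real_derivative b' t) (at t)" "(b' has_real_derivative - (q t * b t)) (at t)"
    and pa: "a (t + 1) = a t" and pb: "b (t + 1) = b t" for t
    using a b by (auto simp: hill_solution_def)
  have pa': "a' (t + 1) = a' t" for t
    using has_real_derivative_periodic[of a a'] pa da by blast
  have pb': "b' (t + 1) = b' t" for t
    using has_real_derivative_periodic[of b b'] pb db by blast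
  show ?thesis
  proof (rule has_integral_periodic_derivative[of "\<lambda>t. a t * b' t - a' t * b t"])
    show "a (t + 1) * b' (t + 1) - a' (t + 1) * b (t + 1) = a t * b' t - a' t * b t" for t
      by (simp add: pa pb pa' pb')
    show "((\<lambda>t. a t * b' t - a' t * b t) has_real_derivative (p t - q t) * (a t * b t)) (at t)" for t
      by (rule derivative_eq_intros da db refl)+ (simp add: algebra_simps)
  qed
qed

text \<open>With \<open>a E t\<close> in place of \<open>a0 t\<close> the integral is exactly 0 by
  Green's identity, so only the error of replacing \<open>a E\<close> by its limit has to be
  estimated. Since \<open>(Q E t - c) / E\<close> is bounded by \<open>K\<close>, uniform
  convergence without any rate makes this error small.\<close>

lemma hill_solution_first_order:
  assumes sol: "\<forall>\<^sub>F E in at 0. hill_solution (Q E) (a E) (a' E)"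
    and b: "hill_solution (\<lambda>_. c) b b'"
    and bound: "\<forall>\<^sub>F E in at 0. \<forall>t\<in>{0..1}. \<bar>Q E t - c\<bar> \<le> K * \<bar>E\<bar>"
    and cont: "\<forall>\<^sub>F E in at 0. continuous_on {0..1} (Q E)"
    and lim: "uniform_limit {0..1} a a0 (at 0)"
    and a0: "continuous_on {0..1} a0"
  shows "((\<lambda>E. integral {0..1} (\<lambda>t. (Q E t - c) / E * (a0 t * b t))) \<longlongrightarrow> 0) (at (0::real))"
proof (rule tendstoI)
  fix e :: real assume "e > 0"
  have cb: "continuous_on {0..1} b"
    using hill_solution_continuous[OF b] .
  have "compact (b ` {0..1})"
    by (rule compact_continuous_image[OF cb]) simp
  then obtain M where "\<forall>x\<in>b ` {0..1}. norm x \<le> M"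
    using compact_imp_bounded bounded_iff by metis
  then have M: "\<bar>b t\<bar> \<le> M" if "t \<in> {0..1}" for t
    using that by auto
  \<comment> \<open>Makes the error bound \<open>\<bar>K\<bar> * d * \<bar>M\<bar>\<close> smaller
    than \<open>e / 2\<close>; the \<open>+ 1\<close> keeps the denominator positive when
    \<open>K\<close> or \<open>M\<close> is 0.\<close>
  define d where "d = e / (2 * (\<bar>K\<bar> * \<bar>M\<bar> + 1))"
  have d: "d > 0" unfolding d_def using \<open>e > 0\<close> by (auto intro!: divide_pos_pos add_nonneg_pos)
  have KMd: "\<bar>K\<bar> * d * \<bar>M\<bar> < e"
  proof -
    have pos: "\<bar>K\<bar> * \<bar>M\<bar> + 1 > 0" by (simp add: add_nonneg_pos)
    have "\<bar>K\<bar> * d * \<bar>M\<bar> < (\<bar>K\<bar> * \<bar>M\<bar> + 1) * d"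
      using d by (simp add: algebra_simps)
    also have "\<dots> = e / 2"
      unfolding d_def using pos by (metis (no_types) less_irrefl mult.commute
          divide_divide_eq_left nonzero_mult_div_cancel_left times_divide_eq_right)
    also have "\<dots> < e" using \<open>e > 0\<close> by simp
    finally show ?thesis .
  qed
  have lim': "\<forall>\<^sub>F E in at 0. \<forall>t\<in>{0..1}. dist (a E t) (a0 t) < d"
    using uniform_limitD[OF lim d] .
  have "\<forall>\<^sub>F E in at (0::real). E \<noteq> 0" by (simp add: eventually_at_filter)
  then show "\<forall>\<^sub>F E in at 0. dist (integral {0..1} (\<lambda>t. (Q E t - c) / E * (a0 t * b t))) 0 < e"
    using sol bound cont lim'
  proof eventually_elim
    case (elim E)
    have ca: "continuous_on {0..1} (a E)"
      using hill_solution_continuous[OF elim(2)] .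
    have "((\<lambda>t. (Q E t - c) * (a E t * b t) / E) has_integral 0) {0..1}"
      using has_integral_divide[OF hill_solution_pairing[OF elim(2) b], of E] by simp
    then have z: "((\<lambda>t. (Q E t - c) / E * (a E t * b t)) has_integral 0) {0..1}"
      by simp
    have "((\<lambda>t. (Q E t - c) / E * (a0 t * b t)) has_integral
          integral {0..1} (\<lambda>t. (Q E t - c) / E * (a0 t * b t))) {0..1}"
      by (intro integrable_integral integrable_continuous_interval continuous_intros
          a0 cb elim(4)) (use elim in auto)
    \<comment> \<open>Subtracting a vanishing integral keeps the value and leaves the small factor
      \<open>a0 t - a E t\<close> in the integrand.\<close>
    from has_integral_diff[OF this z]
    have hi: "((\<lambda>t. (Q E t - c) / E * (a0 t - a E t) * b t) has_integral
          integral {0..1} (\<lambda>t. (Q E t - c) / E * (a0 t * b t))) {0..1}"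
      by (rule has_integral_eq_rhs[OF has_integral_eq[rotated]])
         (simp_all only: diff_0_right right_diff_distrib left_diff_distrib mult.assoc)
    have "norm (integral {0..1} (\<lambda>t. (Q E t - c) / E * (a0 t * b t))) \<le>
          \<bar>K\<bar> * d * \<bar>M\<bar> * measure lborel (cbox 0 (1::real))"
    proof (rule has_integral_bound[rotated])
      show "((\<lambda>t. (Q E t - c) / E * (a0 t - a E t) * b t) has_integral
          integral {0..1} (\<lambda>t. (Q E t - c) / E * (a0 t * b t))) (cbox 0 1)"
        using hi by simp
      fix t :: real assume "t \<in> cbox 0 1"
      then have t: "t \<in> {0..1}" by simp
      have "\<bar>(Q E t - c) / E\<bar> \<le> K"
        using elim(1,3) t by (simp add: field_simps)
      moreover have "\<bar>a0 t - a E t\<bar> \<le> d"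
        using elim(5) t by (force simp: dist_real_def)
      moreover have "\<bar>b t\<bar> \<le> \<bar>M\<bar>" using M[OF t] by simp
      ultimately show "norm ((Q E t - c) / E * (a0 t - a E t) * b t) \<le> \<bar>K\<bar> * d * \<bar>M\<bar>"
        unfolding real_norm_def abs_mult by (intro mult_mono) auto
    qed (use d in auto)
    also have "\<dots> < e" using KMd by simp
    finally show ?case by simp
  qed
qed

section \<open>Energy estimate and continuous dependence on the coefficient\<close>

text \<open>The energy \<open>e = d^2 + d'^2\<close> grows at rate at most
  \<open>L * (e + \<delta>^2)\<close> on [0, 1], so
  \<open>(e + \<delta>^2) * exp (- (L * t))\<close> does not increase, and it starts at
  \<open>\<delta>^2\<close>. The case \<open>\<delta> = 0\<close> is uniqueness for the initial
  value problem; \<open>\<delta>\<close> of order \<open>E\<close> gives continuous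
  dependence.\<close>

lemma gronwall_second_order:
  fixes d d' q r :: "real \<Rightarrow> real"
  assumes d: "\<And>t. (d has_real_derivative d' t) (at t)"
    and d': "\<And>t. (d' has_real_derivative - (q t * d t) + r t) (at t)"
    and init: "d 0 = 0" "d' 0 = 0"
    and q: "\<And>t. t \<in> {0..1} \<Longrightarrow> \<bar>q t\<bar> \<le> M"
    and r: "\<And>t. t \<in> {0..1} \<Longrightarrow> \<bar>r t\<bar> \<le> \<delta>"
    and t: "t \<in> {0..1}"
  shows "(d t)\<^sup>2 \<le> \<delta>\<^sup>2 * exp (M + 2)"
proof -
  have M: "M \<ge> 0" using q[of 0] by auto
  \<comment> \<open>\<open>M\<close> absorbs the term with \<open>q\<close>; one further unit is
    spent on \<open>2 * d * d'\<close> and one on \<open>2 * d' * r\<close>.\<close>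
  define L where "L = M + 2"
  define e where "e t = (d t)\<^sup>2 + (d' t)\<^sup>2" for t
  define g where "g t = (e t + \<delta>\<^sup>2) * exp (- (L * t))" for t
  define g' where "g' t = (2 * d t * d' t + 2 * d' t * (- (q t * d t) + r t) - L * (e t + \<delta>\<^sup>2))
      * exp (- (L * t))" for t
  have "(g has_real_derivative g' s) (at s)" for s
    unfolding g_def e_def g'_def
    by (rule derivative_eq_intros d d' refl)+ (simp add: algebra_simps power2_eq_square)
  moreover have "g' s \<le> 0" if s: "s \<in> {0..1}" for s
  proof -
    have 1: "2 * d s * d' s \<le> e s"
      unfolding e_def using sum_squares_bound[of "d s" "d' s"] by simp
    have 2: "2 * d' s * (- (q s * d s)) \<le> M * e s"
    proof -
      have "2 * d' s * (- (q s * d s)) \<le> \<bar>q s\<bar> * (2 * \<bar>d s\<bar> * \<bar>d' s\<bar>)"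
        using abs_ge_self[of "2 * d' s * (- (q s * d s))"] by (simp add: abs_mult mult_ac)
      also have "\<dots> \<le> M * e s"
        unfolding e_def using q[OF s] sum_squares_bound[of "\<bar>d s\<bar>" "\<bar>d' s\<bar>"] M
        by (intro mult_mono) auto
      finally show ?thesis .
    qed
    have 3: "2 * d' s * r s \<le> e s + \<delta>\<^sup>2"
    proof -
      have "2 * d' s * r s \<le> (d' s)\<^sup>2 + (r s)\<^sup>2" using sum_squares_bound[of "d' s" "r s"] .
      moreover have "(r s)\<^sup>2 \<le> \<delta>\<^sup>2" using r[OF s] by (metis abs_ge_zero power2_abs power_mono)
      ultimately show ?thesis unfolding e_def using zero_le_power2[of "d s"] by linarith
    qed
    have "L * (e s + \<delta>\<^sup>2) = M * e s + e s + e s + L * \<delta>\<^sup>2" by (simp add: L_def algebra_simps)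
    moreover have "L * \<delta>\<^sup>2 \<ge> 1 * \<delta>\<^sup>2" using M by (intro mult_right_mono) (auto simp: L_def)
    ultimately show ?thesis
      unfolding g'_def using 1 2 3
      by (intro mult_nonpos_nonneg) (auto simp: distrib_left right_diff_distrib)
  qed
  ultimately have "g t \<le> g 0"
    using t by (intro DERIV_nonpos_imp_nonincreasing[of 0 t g]) (auto intro!: exI)
  then have "(e t + \<delta>\<^sup>2) * exp (- (L * t)) \<le> \<delta>\<^sup>2" by (simp add: g_def e_def init)
  then have "e t + \<delta>\<^sup>2 \<le> \<delta>\<^sup>2 * exp (L * t)" by (simp add: exp_minus field_simps)
  also have "\<dots> \<le> \<delta>\<^sup>2 * exp L"
    using t M by (intro mult_left_mono) (auto simp: L_def mult_left_le)
  finally have "e t \<le> \<delta>\<^sup>2 * exp L" by (smt (verit) zero_le_power2)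
  then show ?thesis by (smt (verit) e_def L_def zero_le_power2)
qed

lemma periodic_eq_frac:
  fixes f :: "real \<Rightarrow> 'a"
  assumes "\<And>t. f (t + 1) = f t"
  shows "f t = f (frac t)"
proof -
  have nat: "f (t + of_nat n) = f t" for t and n :: nat
    by (induction n) (simp_all add: assms add.assoc[symmetric] add.commute[of 1])
  have "f (t + of_int k) = f t" for t and k :: int
  proof (cases "k \<ge> 0")
    case True
    then show ?thesis using nat[of t "nat k"] by simp
  next
    case False
    then show ?thesis using nat[of "t + of_int k" "nat (- k)"] by simp
  qed
  from this[of "frac t" "\<lfloor>t\<rfloor>"] show ?thesis by (simp add: frac_def)
qed

text \<open>A real coefficient commutes with \<open>Re\<close> and \<open>Im\<close>. One
  \<open>A'\<close> serves both parts, and the last clause lets its value at 0 be read off from the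
  derivative of \<open>A\<close>.\<close>

lemma periodic_solutions_Re_Im:
  assumes "A \<in> periodic_solutions q"
  obtains A' where "hill_solution q (\<lambda>t. Re (A t)) (\<lambda>t. Re (A' t))"
    "hill_solution q (\<lambda>t. Im (A t)) (\<lambda>t. Im (A' t))"
    "\<And>t. (A has_vector_derivative A' t) (at t)"
proof -
  from assms obtain A' A'' where per: "\<And>t. A (t + 1) = A t"
    and d: "\<And>t. (A has_vector_derivative A' t) (at t)"
    "\<And>t. (A' has_vector_derivative A'' t) (at t)"
    and eq: "\<And>t. - A'' t = complex_of_real (q t) * A t"
    unfolding periodic_solutions_def by blast
  have eq': "A'' t = - (complex_of_real (q t) * A t)" for t
    using eq[of t] by (metis minus_minus)
  have re: "((\<lambda>t. Re (f t)) has_real_derivative Re f') (at t)"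
    and im: "((\<lambda>t. Im (f t)) has_real_derivative Im f') (at t)"
    if "(f has_vector_derivative f') (at t)" for f f' and t :: real
    unfolding has_real_derivative_iff_has_vector_derivative
    using bounded_linear.has_vector_derivative[OF bounded_linear_Re that]
      bounded_linear.has_vector_derivative[OF bounded_linear_Im that] .
  show ?thesis
    using that[of A'] re[OF d(1)] re[OF d(2)] im[OF d(1)] im[OF d(2)] per d
    by (auto simp: hill_solution_def eq')
qed

text \<open>The difference \<open>a E - b\<close> has zero initial data and solves the equation with
  coefficient \<open>Q E\<close> and source \<open>- (Q E t - c) * b t\<close>, which is of order
  \<open>E\<close> uniformly on [0, 1]; the energy estimate gives a bound of the same order for the
  difference.\<close>

lemma hill_solution_uniform_limit:
  assumes sol: "\<forall>\<^sub>F E in at 0. hill_solution (Q E) (a E) (a' E) \<and> a E 0 = b 0 \<and> a' E 0 = b' 0"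
    and b: "hill_solution (\<lambda>_. c) b b'"
    and bound: "\<forall>\<^sub>F E in at 0. \<forall>t\<in>{0..1}. \<bar>Q E t - c\<bar> \<le> K * \<bar>E\<bar>"
  shows "uniform_limit {0..1} a b (at (0::real))"
proof (rule uniform_limitI)
  fix e :: real assume e: "e > 0"
  have "compact (b ` {0..1})"
    by (rule compact_continuous_image[OF hill_solution_continuous[OF b]]) simp
  then obtain B where "\<forall>x\<in>b ` {0..1}. norm x \<le> B"
    using compact_imp_bounded bounded_iff by metis
  then have B: "\<bar>b t\<bar> \<le> B" if "t \<in> {0..1}" for t
    using that by auto
  \<comment> \<open>A bound for \<open>Q E\<close> on [0, 1] that is the same for all
    \<open>E\<close> near 0 with absolute value below 1.\<close>
  define M where "M = \<bar>c\<bar> + \<bar>K\<bar>"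
  have "((\<lambda>E::real. (K * \<bar>E\<bar> * B)\<^sup>2 * exp (M + 2)) \<longlongrightarrow> (K * \<bar>0\<bar> * B)\<^sup>2 * exp (M + 2)) (at 0)"
    by (intro tendsto_intros)
  then have small: "\<forall>\<^sub>F E in at (0::real). (K * \<bar>E\<bar> * B)\<^sup>2 * exp (M + 2) < e\<^sup>2"
    using e by (intro order_tendstoD) auto
  have "\<forall>\<^sub>F E in at (0::real). E \<in> {-1<..<1}"
    by (rule eventually_at_in_open') auto
  then show "\<forall>\<^sub>F E in at 0. \<forall>t\<in>{0..1}. dist (a E t) (b t) < e"
    using sol bound small
  proof eventually_elim
    case (elim E)
    show ?case
    proof
      fix t :: real assume t: "t \<in> {0..1}"
      have "(a E t - b t)\<^sup>2 \<le> (K * \<bar>E\<bar> * B)\<^sup>2 * exp (M + 2)"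
      proof (rule gronwall_second_order[where d = "\<lambda>t. a E t - b t" and d' = "\<lambda>t. a' E t - b' t"
            and q = "Q E" and r = "\<lambda>t. - (Q E t - c) * b t"])
        fix s :: real
        show "((\<lambda>t. a E t - b t) has_real_derivative a' E s - b' s) (at s)"
          using elim(2) b unfolding hill_solution_def by (intro derivative_intros) auto
        have "((\<lambda>t. a' E t - b' t) has_real_derivative - (Q E s * a E s) - - (c * b s)) (at s)"
          using elim(2) b unfolding hill_solution_def by (intro derivative_intros) auto
        then show "((\<lambda>t. a' E t - b' t) has_real_derivative
            - (Q E s * (a E s - b s)) + - (Q E s - c) * b s) (at s)"
          by (simp add: algebra_simps)
      next
        fix s :: real assume s: "s \<in> {0..1}"
        have Qc: "\<bar>Q E s - c\<bar> \<le> K * \<bar>E\<bar>" using elim(3) s by blast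
        also have "\<dots> \<le> \<bar>K\<bar> * 1" using elim(1) by (intro mult_mono) auto
        finally show "\<bar>Q E s\<bar> \<le> M" by (simp add: M_def)
        show "\<bar>- (Q E s - c) * b s\<bar> \<le> K * \<bar>E\<bar> * B"
          using Qc B[OF s] unfolding abs_mult abs_minus_cancel by (intro mult_mono) auto
      qed (use elim(2) t in simp_all)
      also have "\<dots> < e\<^sup>2" using elim by blast
      finally have "\<bar>a E t - b t\<bar>\<^sup>2 < e\<^sup>2" by simp
      then show "dist (a E t) (b t) < e"
        unfolding dist_real_def by (rule power_less_imp_less_base) (use e in simp)
    qed
  qed
qed

section \<open>The space of periodic solutions and its initial values\<close>

lemma periodic_solutions_lincomb:
  assumes "f \<in> periodic_solutions q" "g \<in> periodic_solutions q"
  shows "(\<lambda>t. \<alpha> * f t + \<beta> * g t) \<in> periodic_solutions q"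
proof -
  obtain f' f'' g' g'' where
    f: "\<And>t. f (t + 1) = f t" "\<And>t. (f has_vector_derivative f' t) (at t)"
      "\<And>t. (f' has_vector_derivative f'' t) (at t)" "\<And>t. - f'' t = complex_of_real (q t) * f t"
    and g: "\<And>t. g (t + 1) = g t" "\<And>t. (g has_vector_derivative g' t) (at t)"
      "\<And>t. (g' has_vector_derivative g'' t) (at t)" "\<And>t. - g'' t = complex_of_real (q t) * g t"
    using assms unfolding periodic_solutions_def by blast
  have "((\<lambda>t. \<alpha> * f t + \<beta> * g t) has_vector_derivative \<alpha> * f' t + \<beta> * g' t) (at t)"
    "((\<lambda>t. \<alpha> * f' t + \<beta> * g' t) has_vector_derivative \<alpha> * f'' t + \<beta> * g'' t) (at t)" for t
    by (intro has_vector_derivative_add has_vector_derivative_mult_right f g)+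
  moreover have "- (\<alpha> * f'' t + \<beta> * g'' t) = complex_of_real (q t) * (\<alpha> * f t + \<beta> * g t)" for t
  proof -
    have "- (\<alpha> * f'' t + \<beta> * g'' t) = \<alpha> * (- f'' t) + \<beta> * (- g'' t)" by simp
    also have "\<dots> = complex_of_real (q t) * (\<alpha> * f t + \<beta> * g t)"
      unfolding f g by (simp add: algebra_simps)
    finally show ?thesis .
  qed
  ultimately show ?thesis
    unfolding periodic_solutions_def using f(1) g(1)
    by (intro CollectI conjI allI exI[of _ "\<lambda>t. \<alpha> * f' t + \<beta> * g' t"]
        exI[of _ "\<lambda>t. \<alpha> * f'' t + \<beta> * g'' t"]) auto
qed

text \<open>The energy estimate without source annihilates real and imaginary part on [0, 1];
  periodicity carries this to the whole line through \<open>frac t\<close>.\<close>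

lemma periodic_solutions_eq_zero:
  assumes A: "A \<in> periodic_solutions q"
    and q: "\<And>t. t \<in> {0..1} \<Longrightarrow> \<bar>q t\<bar> \<le> M"
    and init: "A 0 = 0" "(A has_vector_derivative 0) (at 0)"
  shows "A = 0"
proof
  fix t :: real
  obtain A' where A': "hill_solution q (\<lambda>t. Re (A t)) (\<lambda>t. Re (A' t))"
    "hill_solution q (\<lambda>t. Im (A t)) (\<lambda>t. Im (A' t))"
    "\<And>t. (A has_vector_derivative A' t) (at t)"
    using periodic_solutions_Re_Im[OF A] by blast
  have A'0: "A' 0 = 0"
    using vector_derivative_unique_at[OF A'(3) init(2)] .
  have zero: "a s = 0" if "hill_solution q a a'" "a 0 = 0" "a' 0 = 0" "s \<in> {0..1}" for a a' s
  proof -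
    have "(a s)\<^sup>2 \<le> 0\<^sup>2 * exp (M + 2)"
      using that by (intro gronwall_second_order[where d' = a' and q = q and r = "\<lambda>_. 0"])
        (auto simp: hill_solution_def q)
    then show ?thesis by simp
  qed
  have s: "frac t \<in> {0..1}" using frac_lt_1[of t] by (simp add: less_imp_le)
  have "A (frac t) = 0"
    using zero[OF A'(1) _ _ s] zero[OF A'(2) _ _ s] by (simp add: init A'0 complex_eq_iff)
  moreover have "A (t + 1) = A t" for t
    using A by (auto simp: periodic_solutions_def)
  ultimately show "A t = 0 t" using periodic_eq_frac[of A t] by simp
qed

text \<open>Uniqueness embeds the periodic solutions into the plane of initial values, so dimension two
  forces every initial value to be attained.\<close>

lemma hill_solution_initial_values:
  assumes dim: "solution_dim q = 2"
    and q: "\<And>t. t \<in> {0..1} \<Longrightarrow> \<bar>q t\<bar> \<le> M"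
  shows "\<exists>a a'. hill_solution q a a' \<and> a 0 = x \<and> a' 0 = y"
proof -
  interpret V: vector_space "\<lambda>(c::complex) (A :: real \<Rightarrow> complex) t. c * A t"
    by (rule vector_space_complex_fun)
  obtain B where B: "B \<subseteq> periodic_solutions q" "V.independent B" "card B = 2"
    using V.basis_exists[of "periodic_solutions q"] dim unfolding solution_dim_def by metis
  obtain f g where fg: "B = {f, g}" "f \<noteq> g"
    using B(3) by (meson card_2_iff)
  have fP: "f \<in> periodic_solutions q" and gP: "g \<in> periodic_solutions q"
    using B(1) fg by auto
  obtain f' where f': "\<And>t. (f has_vector_derivative f' t) (at t)"
    using periodic_solutions_Re_Im[OF fP] by metis
  obtain g' where g': "\<And>t. (g has_vector_derivative g' t) (at t)"
    using periodic_solutions_Re_Im[OF gP] by metis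
  have deriv_comb: "((\<lambda>t. \<alpha> * f t + \<beta> * g t) has_vector_derivative \<alpha> * f' t + \<beta> * g' t) (at t)" for \<alpha> \<beta> t
    by (intro has_vector_derivative_add has_vector_derivative_mult_right f' g')
  \<comment> \<open>By uniqueness a combination with zero initial data vanishes identically, against
    the independence of \<open>f\<close> and \<open>g\<close>.\<close>
  have trivial: False if "\<alpha> * f 0 + \<beta> * g 0 = 0" "\<alpha> * f' 0 + \<beta> * g' 0 = 0" "\<alpha> \<noteq> 0 \<or> \<beta> \<noteq> 0" for \<alpha> \<beta>
  proof -
    have "(\<lambda>t. \<alpha> * f t + \<beta> * g t) = 0"
      using periodic_solutions_eq_zero[OF periodic_solutions_lincomb[OF fP gP] q, of \<alpha> \<beta>]
        that(1,2) deriv_comb[of \<alpha> \<beta> 0] by simp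
    then have z: "\<alpha> * f t + \<beta> * g t = 0" for t by (metis zero_fun_def)
    \<comment> \<open>Whichever function has a nonzero coefficient is a multiple of the other; the
      names \<open>u\<close> and \<open>v\<close> let one dependence argument serve both
      cases.\<close>
    have "\<exists>u v. u \<in> {f, g} \<and> v \<in> {f, g} \<and> u \<noteq> v \<and> (\<exists>c. u = (\<lambda>t. c * v t))"
    proof (cases "\<alpha> = 0")
      case False
      then have "f = (\<lambda>t. (- \<beta> / \<alpha>) * g t)"
        using z by (simp add: fun_eq_iff field_simps eq_neg_iff_add_eq_0)
      then show ?thesis using fg(2) by (intro exI[of _ f] exI[of _ g] conjI exI[of _ "- \<beta> / \<alpha>"]) auto
    next
      case True
      then have "g = (\<lambda>t. 0 * f t)" using z that(3) by (simp add: fun_eq_iff)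
      then show ?thesis using fg(2) by (intro exI[of _ g] exI[of _ f] conjI exI[of _ 0]) auto
    qed
    then obtain u v c where uv: "{f, g} = {u, v}" "u \<noteq> v" "u = (\<lambda>t. c * v t)" by blast
    have "u \<in> V.span {v}"
      unfolding uv(3) by (intro V.span_scale V.span_base) simp
    moreover have "{u, v} - {u} = {v}" using uv(2) by auto
    ultimately have "V.dependent {u, v}"
      unfolding V.dependent_def by (intro bexI[of _ u]) auto
    then show False using B(2) fg(1) uv(1) by simp
  qed
  \<comment> \<open>The Wronskian at 0: the determinant of the map from coefficients to the initial
    values of the combination.\<close>
  define W where "W = f 0 * g' 0 - f' 0 * g 0"
  have W: "W \<noteq> 0"
  proof
    assume "W = 0"
    \<comment> \<open>The coefficient pairs are the columns of the adjugate matrix; for a vanishing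
      determinant both initial values of these combinations are 0.\<close>
    then have "g' 0 * f 0 + (- f' 0) * g 0 = 0" "(- g 0) * f' 0 + f 0 * g' 0 = 0"
      by (simp_all add: W_def algebra_simps)
    then have "f 0 = 0" "g 0 = 0" "f' 0 = 0" "g' 0 = 0"
      using trivial[of "g' 0" "- f' 0"] trivial[of "- g 0" "f 0"] by (auto simp: algebra_simps)
    then show False using trivial[of 1 0] by simp
  qed
  \<comment> \<open>Cramer's rule for the initial values \<open>x\<close> and
    \<open>y\<close>.\<close>
  define \<alpha> \<beta> where "\<alpha> = (of_real x * g' 0 - of_real y * g 0) / W"
    and "\<beta> = (f 0 * of_real y - f' 0 * of_real x) / W"
  define u where "u = (\<lambda>t. \<alpha> * f t + \<beta> * g t)"
  have \<alpha>W: "\<alpha> * W = of_real x * g' 0 - of_real y * g 0" and \<beta>W: "\<beta> * W = f 0 * of_real y - f' 0 * of_real x"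
    unfolding \<alpha>_def \<beta>_def using W by simp_all
  have "(\<alpha> * f 0 + \<beta> * g 0) * W = (\<alpha> * W) * f 0 + (\<beta> * W) * g 0"
    by (simp only: algebra_simps)
  also have "\<dots> = of_real x * W"
    unfolding \<alpha>W \<beta>W unfolding W_def by (simp add: algebra_simps)
  finally have u0: "u 0 = of_real x" using W by (simp add: u_def)
  have "(\<alpha> * f' 0 + \<beta> * g' 0) * W = (\<alpha> * W) * f' 0 + (\<beta> * W) * g' 0"
    by (simp only: algebra_simps)
  also have "\<dots> = of_real y * W"
    unfolding \<alpha>W \<beta>W unfolding W_def by (simp add: algebra_simps)
  finally have u1: "(u has_vector_derivative of_real y) (at 0)"
    using W deriv_comb[of \<alpha> \<beta> 0] by (simp add: u_def)
  have "u \<in> periodic_solutions q"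
    unfolding u_def by (rule periodic_solutions_lincomb[OF fP gP])
  then obtain u' where u': "hill_solution q (\<lambda>t. Re (u t)) (\<lambda>t. Re (u' t))"
    "\<And>t. (u has_vector_derivative u' t) (at t)"
    using periodic_solutions_Re_Im by metis
  have "u' 0 = of_real y" using vector_derivative_unique_at[OF u'(2) u1] .
  \<comment> \<open>\<open>x\<close> and \<open>y\<close> are real, so passing to the real part
    keeps the initial values.\<close>
  then show ?thesis using u' u0 by (intro exI[of _ "\<lambda>t. Re (u t)"] exI[of _ "\<lambda>t. Re (u' t)"]) auto
qed

section \<open>From the first-order condition to the derivative of the eigenvalue\<close>

text \<open>A limit at 0 can be tested along sequences, and for sequences within distance
  \<open>d\<close> of 0 integrability and domination hold at every index, so sequential dominated
  convergence applies.\<close>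

lemma integral_dominated_convergence_at_0:
  fixes f :: "real \<Rightarrow> real \<Rightarrow> real"
  assumes int: "\<forall>\<^sub>F E in at 0. f E integrable_on S"
    and bound: "\<forall>\<^sub>F E in at 0. \<forall>t\<in>S. \<bar>f E t\<bar> \<le> g t"
    and g: "g integrable_on S"
    and lim: "\<And>t. t \<in> S \<Longrightarrow> ((\<lambda>E. f E t) \<longlongrightarrow> F t) (at 0)"
  shows "F integrable_on S" "((\<lambda>E. integral S (f E)) \<longlongrightarrow> integral S F) (at 0)"
proof -
  from eventually_conj[OF int bound] obtain d where d: "d > 0"
    "\<And>E. E \<noteq> 0 \<Longrightarrow> \<bar>E\<bar> < d \<Longrightarrow> f E integrable_on S \<and> (\<forall>t\<in>S. \<bar>f E t\<bar> \<le> g t)"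
    unfolding eventually_at by (auto simp: dist_real_def)
  have seq: "F integrable_on S \<and> (\<lambda>n. integral S (f (X n))) \<longlonglongrightarrow> integral S F"
    if X: "\<And>n. X n \<noteq> 0" "\<And>n. \<bar>X n\<bar> < d" "X \<longlonglongrightarrow> 0" for X
  proof -
    have fX: "f (X n) integrable_on S" and bX: "\<And>t. t \<in> S \<Longrightarrow> norm (f (X n) t) \<le> g t" for n
      using d(2)[OF X(1) X(2)] by simp_all
    have lX: "(\<lambda>n. f (X n) t) \<longlonglongrightarrow> F t" if "t \<in> S" for t
      using filterlim_compose[OF lim[OF that], of X sequentially] X
      by (simp add: filterlim_at)
    show ?thesis
      using dominated_convergence[OF fX g bX lX] by blast
  qed
  have "((\<lambda>E. integral S (f E)) \<longlongrightarrow> integral S F) (at 0 within ball 0 d)"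
    unfolding tendsto_at_iff_sequentially o_def
  proof (intro allI impI)
    fix X :: "nat \<Rightarrow> real" assume X: "\<forall>n. X n \<in> ball 0 d - {0}" "X \<longlonglongrightarrow> 0"
    have "X n \<noteq> 0" "\<bar>X n\<bar> < d" for n
      using X(1)[rule_format, of n] by auto
    then show "(\<lambda>n. integral S (f (X n))) \<longlonglongrightarrow> integral S F"
      by (rule conjunct2[OF seq[OF _ _ X(2)]])
  qed
  then show "((\<lambda>E. integral S (f E)) \<longlongrightarrow> integral S F) (at 0)"
    using d(1) by (simp add: at_within_open[of 0 "ball 0 d"])
  \<comment> \<open>Integrability of the limit function requires exhibiting one admissible
    sequence.\<close>
  have "(\<lambda>n. (d / 2) * inverse (real (Suc n))) \<longlonglongrightarrow> (d / 2) * 0"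
    by (intro tendsto_intros LIMSEQ_inverse_real_of_nat)
  moreover have "\<bar>(d / 2) * inverse (real (Suc n))\<bar> < d" for n
  proof -
    have "\<bar>(d / 2) * inverse (real (Suc n))\<bar> \<le> (d / 2) * 1"
      using d unfolding abs_mult by (intro mult_mono) (auto simp: field_simps)
    then show ?thesis using d by linarith
  qed
  ultimately show "F integrable_on S"
    using d by (intro conjunct1[OF seq[of "\<lambda>n. (d / 2) * inverse (real (Suc n))"]]) auto
qed

text \<open>The splitting \<open>\<nu> * p + s - c = (\<nu> - c) * p + c * (p - 1) + s\<close>,
  divided by \<open>E\<close> and integrated against \<open>\<phi>\<close>, is a linear equation for
  the difference quotient \<open>(\<nu> E - c) / E\<close>. Its leading coefficient, the integral of
  \<open>p * \<phi>\<close>, tends to \<open>J\<close>, so for \<open>J \<noteq> 0\<close> it can be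
  solved near \<open>E = 0\<close>, and differentiability of \<open>\<nu>\<close> comes out together
  with the value.\<close>

lemma eigenvalue_has_real_derivative:
  fixes \<nu> :: "real \<Rightarrow> real" and p s :: "real \<Rightarrow> real \<Rightarrow> real"
  assumes \<nu>0: "\<nu> 0 = c"
    and p_cont: "\<forall>\<^sub>F E in at 0. continuous_on {0..1} (p E)"
    and s_cont: "\<forall>\<^sub>F E in at 0. continuous_on {0..1} (s E)"
    and \<phi>: "continuous_on {0..1} \<phi>"
    and p_bound: "\<forall>\<^sub>F E in at 0. \<forall>t\<in>{0..1}. \<bar>p E t - 1\<bar> \<le> K * \<bar>E\<bar>"
    and p_lim: "\<And>t. t \<in> {0..1} \<Longrightarrow> ((\<lambda>E. (p E t - 1) / E) \<longlongrightarrow> H t) (at 0)"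
    and s_lim: "((\<lambda>E. integral {0..1} (\<lambda>t. s E t / E * \<phi> t)) \<longlongrightarrow> 0) (at 0)"
    and first_order: "((\<lambda>E. integral {0..1} (\<lambda>t. (\<nu> E * p E t + s E t - c) / E * \<phi> t)) \<longlongrightarrow> 0) (at 0)"
    and I\<phi>: "(\<phi> has_integral J) {0..1}" "J \<noteq> 0"
  shows "(\<lambda>t. H t * \<phi> t) integrable_on {0..1}"
    "(\<nu> has_real_derivative - c * integral {0..1} (\<lambda>t. H t * \<phi> t) / J) (at 0)"
proof -
  let ?X = "\<lambda>E. integral {0..1} (\<lambda>t. (p E t - 1) / E * \<phi> t)"
  let ?S = "\<lambda>E. integral {0..1} (\<lambda>t. s E t / E * \<phi> t)"
  let ?Z = "\<lambda>E. integral {0..1} (\<lambda>t. (\<nu> E * p E t + s E t - c) / E * \<phi> t)"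
  let ?L = "integral {0..1} (\<lambda>t. H t * \<phi> t)"
  have ne: "\<forall>\<^sub>F E in at (0::real). E \<noteq> 0" by (simp add: eventually_at_filter)
  have int: "\<forall>\<^sub>F E in at 0. (\<lambda>t. (p E t - 1) / E * \<phi> t) integrable_on {0..1}"
    using p_cont ne
    by eventually_elim (intro integrable_continuous_interval continuous_intros \<phi>; simp)
  have bound: "\<forall>\<^sub>F E in at 0. \<forall>t\<in>{0..1}. \<bar>(p E t - 1) / E * \<phi> t\<bar> \<le> K * \<bar>\<phi> t\<bar>"
    using p_bound ne
  proof eventually_elim
    case (elim E)
    have "\<bar>(p E t - 1) / E\<bar> \<le> K" if "t \<in> {0..1}" for t
      using elim that by (simp add: field_simps)
    then show ?case unfolding abs_mult using mult_right_mono[OF _ abs_ge_zero] by blast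
  qed
  have "(\<lambda>t. K * \<bar>\<phi> t\<bar>) integrable_on {0..1}"
    by (intro integrable_continuous_interval continuous_intros \<phi>)
  note dct = integral_dominated_convergence_at_0[OF int bound this, where F = "\<lambda>t. H t * \<phi> t",
      OF tendsto_mult_right[OF p_lim]]
  show "(\<lambda>t. H t * \<phi> t) integrable_on {0..1}" using dct(1) by blast
  have X: "(?X \<longlongrightarrow> ?L) (at 0)" using dct(2) by blast
  have "((\<lambda>E. J + E * ?X E) \<longlongrightarrow> J + 0 * ?L) (at 0)"
    by (intro tendsto_intros X)
  then have Y: "((\<lambda>E. J + E * ?X E) \<longlongrightarrow> J) (at 0)" by simp
  have eq: "\<forall>\<^sub>F E in at 0. (\<nu> E - \<nu> 0) / (E - 0) = (?Z E - c * ?X E - ?S E) / (J + E * ?X E)"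
    using ne p_cont s_cont int tendsto_imp_eventually_ne[OF Y I\<phi>(2)]
  proof eventually_elim
    case (elim E)
    note X = integrable_integral[OF elim(4)]
    have S: "((\<lambda>t. s E t / E * \<phi> t) has_integral ?S E) {0..1}"
      using elim by (intro integrable_integral integrable_continuous_interval continuous_intros \<phi>) auto
    \<comment> \<open>The first bracket is \<open>p E t * \<phi> t\<close>, written so that its
      integral reads \<open>J + E * ?X E\<close> with \<open>?X\<close> convergent.\<close>
    have "((\<lambda>t. (\<nu> E - c) / E * (\<phi> t + E * ((p E t - 1) / E * \<phi> t)) + c * ((p E t - 1) / E * \<phi> t)
        + s E t / E * \<phi> t) has_integral (\<nu> E - c) / E * (J + E * ?X E) + c * ?X E + ?S E) {0..1}"
      by (intro has_integral_add has_integral_mult_right X S I\<phi>)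
    also have "(\<lambda>t. (\<nu> E - c) / E * (\<phi> t + E * ((p E t - 1) / E * \<phi> t)) + c * ((p E t - 1) / E * \<phi> t)
        + s E t / E * \<phi> t) = (\<lambda>t. (\<nu> E * p E t + s E t - c) / E * \<phi> t)"
      using elim(1) by (simp add: fun_eq_iff divide_simps) (simp add: algebra_simps)?
    finally have "?Z E = (\<nu> E - c) / E * (J + E * ?X E) + c * ?X E + ?S E"
      by (rule integral_unique)
    then show ?case using elim by (simp add: \<nu>0)
  qed
  have "((\<lambda>E. (?Z E - c * ?X E - ?S E) / (J + E * ?X E)) \<longlongrightarrow> (0 - c * ?L - 0) / J) (at 0)"
    by (intro tendsto_intros X Y s_lim first_order I\<phi>(2))
  then have "((\<lambda>E. (\<nu> E - \<nu> 0) / (E - 0)) \<longlongrightarrow> - c * ?L / J) (at 0)"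
    using tendsto_cong[OF eq] by simp
  then show "(\<nu> has_real_derivative - c * ?L / J) (at 0)"
    unfolding has_field_derivative_iff by simp
qed

section \<open>Consequences of joint smoothness\<close>

lemma smooth_on_continuous_on: "smooth_on S f \<Longrightarrow> continuous_on S f"
  unfolding smooth_on_def by (metis Ck_on.simps(1))

lemma smooth_on_has_derivative:
  assumes "smooth_on S f" "x \<in> S"
  shows "(f has_derivative frechet_derivative f (at x)) (at x)"
proof -
  have "Ck_on (Suc 0) S f" using assms(1) by (simp only: smooth_on_def)
  then show ?thesis using assms(2) by (simp add: frechet_derivative_works)
qed

lemma smooth_on_frechet_derivative:
  assumes "smooth_on S f"
  shows "smooth_on S (\<lambda>x. frechet_derivative f (at x) v)"
  unfolding smooth_on_def
proof
  fix k
  have "Ck_on (Suc k) S f" using assms by (simp only: smooth_on_def)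
  then show "Ck_on k S (\<lambda>x. frechet_derivative f (at x) v)" by simp
qed

lemma smooth_on_partial_derivatives:
  fixes F :: "real \<times> real \<Rightarrow> real"
  assumes "smooth_on S F" "(E, t) \<in> S"
  shows "((\<lambda>t. F (E, t)) has_real_derivative frechet_derivative F (at (E, t)) (0, 1)) (at t)"
    "((\<lambda>E. F (E, t)) has_real_derivative frechet_derivative F (at (E, t)) (1, 0)) (at E)"
proof -
  let ?D = "frechet_derivative F (at (E, t))"
  have D: "(F has_derivative ?D) (at (E, t))" by (rule smooth_on_has_derivative[OF assms])
  then interpret D: bounded_linear ?D by (rule has_derivative_bounded_linear)
  have "?D (0, s) = ?D (0, 1) * s" "?D (s, 0) = ?D (1, 0) * s" for s
    using D.scaleR[of s "(0, 1)"] D.scaleR[of s "(1, 0)"] by (simp_all add: mult.commute)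
  then have lin: "(\<lambda>s. ?D (0, s)) = (*) (?D (0, 1))" "(\<lambda>s. ?D (s, 0)) = (*) (?D (1, 0))"
    by blast+
  have "((\<lambda>t. (E, t)) has_derivative (\<lambda>s. (0, s))) (at t)"
    "((\<lambda>E. (E, t)) has_derivative (\<lambda>s. (s, 0))) (at E)"
    by (auto intro!: derivative_eq_intros)
  from has_derivative_compose[OF this(1) D] has_derivative_compose[OF this(2) D]
  show "((\<lambda>t. F (E, t)) has_real_derivative ?D (0, 1)) (at t)"
    "((\<lambda>E. F (E, t)) has_real_derivative ?D (1, 0)) (at E)"
    unfolding has_field_derivative_def lin .
qed

text \<open>The \<open>E\<close>-derivative is continuous, hence bounded on the compact product of a
  small ball with [0, 1]; the mean value inequality then gives one constant for all
  \<open>t\<close>.\<close>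

lemma smooth_on_Lipschitz_at_0:
  fixes F :: "real \<times> real \<Rightarrow> real"
  assumes F: "smooth_on (I \<times> UNIV) F" and I: "open I" "0 \<in> I"
  shows "\<exists>K. \<forall>\<^sub>F E in at 0. \<forall>t\<in>{0..1}. \<bar>F (E, t) - F (0, t)\<bar> \<le> K * \<bar>E\<bar>"
proof -
  obtain r where r: "r > 0" "cball 0 r \<subseteq> I"
    using I open_contains_cball by blast
  let ?D = "\<lambda>x. frechet_derivative F (at x) (1, 0)"
  have "continuous_on (I \<times> UNIV) ?D"
    by (intro smooth_on_continuous_on smooth_on_frechet_derivative F)
  then have "continuous_on (cball 0 r \<times> {0..1}) ?D"
    by (rule continuous_on_subset) (use r in auto)
  then have "compact (?D ` (cball 0 r \<times> {0..1}))"
    by (rule compact_continuous_image) (intro compact_Times compact_cball compact_Icc)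
  then obtain K where K: "\<forall>y\<in>?D ` (cball 0 r \<times> {0..1}). norm y \<le> K"
    using compact_imp_bounded bounded_iff by metis
  have "\<bar>F (E, t) - F (0, t)\<bar> \<le> K * \<bar>E\<bar>" if E: "E \<in> cball 0 r" and t: "t \<in> {0..1}" for E t
  proof -
    have "norm (F (E, t) - F (0, t)) \<le> K * norm (E - 0)"
    proof (rule field_differentiable_bound[of "cball 0 r" "\<lambda>E. F (E, t)" "\<lambda>E. ?D (E, t)"])
      fix z :: real assume z: "z \<in> cball 0 r"
      then show "((\<lambda>E. F (E, t)) has_field_derivative ?D (z, t)) (at z within cball 0 r)"
        using r(2) by (intro DERIV_subset[OF smooth_on_partial_derivatives(2)[OF F]]) auto
      show "norm (?D (z, t)) \<le> K" using K z t by blast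
    qed (use E r in auto)
    then show ?thesis by simp
  qed
  moreover have "\<forall>\<^sub>F E in at (0::real). E \<in> cball 0 r"
    by (rule eventually_mono[OF eventually_at_in_open'[of "ball 0 r"]]) (use r in auto)
  ultimately show ?thesis
    by (intro exI[of _ K]) (auto elim!: eventually_mono)
qed

lemma smooth_on_uniform_limit:
  fixes F :: "real \<times> real \<Rightarrow> 'a::real_normed_vector"
  assumes F: "smooth_on (I \<times> UNIV) F" and I: "open I" "0 \<in> I"
  shows "uniform_limit {0..1} (\<lambda>E t. F (E, t)) (\<lambda>t. F (0, t)) (at (0::real))"
proof (rule uniform_limitI)
  fix e :: real assume e: "e > 0"
  obtain r where r: "r > 0" "cball 0 r \<subseteq> I"
    using I open_contains_cball by blast
  have "continuous_on (cball 0 r \<times> {0..1}) F"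
    by (rule continuous_on_subset[OF smooth_on_continuous_on[OF F]]) (use r in auto)
  then have "uniformly_continuous_on (cball 0 r \<times> {0..1}) F"
    by (rule compact_uniformly_continuous) (intro compact_Times compact_cball compact_Icc)
  then obtain d where d: "d > 0"
    "\<And>x y. x \<in> cball 0 r \<times> {0..1} \<Longrightarrow> y \<in> cball 0 r \<times> {0..1} \<Longrightarrow> dist y x < d \<Longrightarrow> dist (F y) (F x) < e"
    using e unfolding uniformly_continuous_on_def by metis
  have "\<forall>\<^sub>F E in at (0::real). E \<in> ball 0 (min r d)"
    by (rule eventually_at_in_open') (use r d in auto)
  then show "\<forall>\<^sub>F E in at 0. \<forall>t\<in>{0..1}. dist (F (E, t)) (F (0, t)) < e"
  proof eventually_elim
    case (elim E)
    show ?case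
    proof
      fix t :: real assume t: "t \<in> {0..1}"
      show "dist (F (E, t)) (F (0, t)) < e"
        using elim t r(1) by (intro d(2)) (auto simp: dist_Pair_Pair dist_commute)
    qed
  qed
qed

section \<open>The conformal factor near the flat metric\<close>

locale torus_deformation =
  fixes I :: "real set" and h :: "real \<Rightarrow> real \<Rightarrow> real"
  assumes flat_deformation: "flat_deformation I h"
begin

lemma I: "open I" "0 \<in> I"
  using flat_deformation by (auto simp: flat_deformation_def)

lemma eventually_in_I: "\<forall>\<^sub>F E in at 0. E \<in> I"
  using I by (intro eventually_at_in_open')

lemma smooth: "smooth_on (I \<times> UNIV) (\<lambda>(E, t). h E t)"
  and pos: "E \<in> I \<Longrightarrow> h E t > 0"
  and periodic: "E \<in> I \<Longrightarrow> h E (t + 1) = h E t"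
  and h_0: "h 0 t = 1"
  using flat_deformation by (auto simp: flat_deformation_def)

text \<open>Taken from the derivative of \<open>h\<close> as a function of two variables, so that
  joint smoothness in \<open>(E, t)\<close> is inherited; for \<open>E \<in> I\<close> it agrees
  with \<open>deriv (h E)\<close>.\<close>

definition h' :: "real \<Rightarrow> real \<Rightarrow> real" where
  "h' E t = frechet_derivative (\<lambda>(E, t). h E t) (at (E, t)) (0, 1)"

definition h'' :: "real \<Rightarrow> real \<Rightarrow> real" where
  "h'' E t = frechet_derivative (\<lambda>(E, t). h' E t) (at (E, t)) (0, 1)"

lemma smooth': "smooth_on (I \<times> UNIV) (\<lambda>(E, t). h' E t)"
  using smooth_on_frechet_derivative[OF smooth, of "(0, 1)"] by (simp add: h'_def case_prod_beta')

lemma smooth'': "smooth_on (I \<times> UNIV) (\<lambda>(E, t). h'' E t)"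
  using smooth_on_frechet_derivative[OF smooth', of "(0, 1)"] by (simp add: h''_def case_prod_beta')

lemma has_derivative_h: "E \<in> I \<Longrightarrow> (h E has_real_derivative h' E t) (at t)"
  and has_derivative_h': "E \<in> I \<Longrightarrow> (h' E has_real_derivative h'' E t) (at t)"
  using smooth_on_partial_derivatives(1)[OF smooth, of E t]
    smooth_on_partial_derivatives(1)[OF smooth', of E t]
  by (simp_all flip: h'_def h''_def)

lemma deriv_h: "E \<in> I \<Longrightarrow> deriv (h E) = h' E"
  and deriv_h': "E \<in> I \<Longrightarrow> deriv (h' E) = h'' E"
  using has_derivative_h has_derivative_h' by (auto intro!: DERIV_imp_deriv)

lemma periodic': "E \<in> I \<Longrightarrow> h' E (t + 1) = h' E t"
  by (rule has_real_derivative_periodic[of "h E"]) (simp_all add: periodic has_derivative_h)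

lemma h'_0: "h' 0 t = 0"
  using has_derivative_h[OF I(2), of t] h_0 DERIV_const[of 1] DERIV_unique
  by (metis (no_types, lifting) ext)

lemma h''_0: "h'' 0 t = 0"
  using has_derivative_h'[OF I(2), of t] h'_0 DERIV_const[of 0] DERIV_unique
  by (metis (no_types, lifting) ext)

lemma continuous_h: "E \<in> I \<Longrightarrow> continuous_on S (h E)"
  and continuous_h': "E \<in> I \<Longrightarrow> continuous_on S (h' E)"
  by (auto intro!: continuous_at_imp_continuous_on DERIV_isCont has_derivative_h has_derivative_h')

lemma continuous_h'': "E \<in> I \<Longrightarrow> continuous_on S (h'' E)"
proof -
  assume "E \<in> I"
  moreover have "continuous_on S (\<lambda>t. (E, t))" by (intro continuous_intros)
  ultimately have "continuous_on S (\<lambda>t. (\<lambda>(E, t). h'' E t) (E, t))"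
    by (intro continuous_on_compose2[OF smooth_on_continuous_on[OF smooth'']]) auto
  then show ?thesis by simp
qed

text \<open>At \<open>E = 0\<close> the factor is the constant 1, so \<open>h - 1\<close>,
  \<open>h'\<close> and \<open>h''\<close> all vanish there and are Lipschitz in \<open>E\<close>
  uniformly in \<open>t\<close>. The clause \<open>K * \<bar>E\<bar> \<le> 1 / 2\<close> keeps
  \<open>h\<close> between 1/2 and 3/2 on [0, 1], which controls quotients by
  \<open>h\<close>.\<close>

lemma near_flat_bounds:
  obtains K where "K \<ge> 0" "\<forall>\<^sub>F E in at 0. E \<in> I \<and> K * \<bar>E\<bar> \<le> 1 / 2 \<and>
    (\<forall>t\<in>{0..1}. \<bar>h E t - 1\<bar> \<le> K * \<bar>E\<bar> \<and> \<bar>h' E t\<bar> \<le> K * \<bar>E\<bar> \<and> \<bar>h'' E t\<bar> \<le> K * \<bar>E\<bar>)"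
proof -
  obtain K0 K1 K2 where
    K: "\<forall>\<^sub>F E in at 0. \<forall>t\<in>{0..1}. \<bar>h E t - 1\<bar> \<le> K0 * \<bar>E\<bar>"
      "\<forall>\<^sub>F E in at 0. \<forall>t\<in>{0..1}. \<bar>h' E t\<bar> \<le> K1 * \<bar>E\<bar>"
      "\<forall>\<^sub>F E in at 0. \<forall>t\<in>{0..1}. \<bar>h'' E t\<bar> \<le> K2 * \<bar>E\<bar>"
    using smooth_on_Lipschitz_at_0[OF smooth I] smooth_on_Lipschitz_at_0[OF smooth' I]
      smooth_on_Lipschitz_at_0[OF smooth'' I] by (auto simp: h_0 h'_0 h''_0)
  define K where "K = \<bar>K0\<bar> + \<bar>K1\<bar> + \<bar>K2\<bar>"
  have le: "K0 * \<bar>E\<bar> \<le> K * \<bar>E\<bar>" "K1 * \<bar>E\<bar> \<le> K * \<bar>E\<bar>" "K2 * \<bar>E\<bar> \<le> K * \<bar>E\<bar>" for E :: real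
    by (intro mult_right_mono; simp add: K_def)+
  have "((\<lambda>E::real. K * \<bar>E\<bar>) \<longlongrightarrow> K * \<bar>0\<bar>) (at 0)"
    by (intro tendsto_intros)
  then have "\<forall>\<^sub>F E in at (0::real). K * \<bar>E\<bar> < 1 / 2"
    by (intro order_tendstoD) auto
  then have "\<forall>\<^sub>F E in at 0. E \<in> I \<and> K * \<bar>E\<bar> \<le> 1 / 2 \<and>
    (\<forall>t\<in>{0..1}. \<bar>h E t - 1\<bar> \<le> K * \<bar>E\<bar> \<and> \<bar>h' E t\<bar> \<le> K * \<bar>E\<bar> \<and> \<bar>h'' E t\<bar> \<le> K * \<bar>E\<bar>)"
    using K eventually_in_I
    by eventually_elim (use le in \<open>auto intro: order_trans\<close>)
  then show thesis by (intro that[of K]) (auto simp: K_def)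
qed

lemma h_pow4_bound:
  obtains K where "\<forall>\<^sub>F E in at 0. \<forall>t\<in>{0..1}. \<bar>h E t ^ 4 - 1\<bar> \<le> K * \<bar>E\<bar>"
proof -
  obtain K where K: "K \<ge> 0" "\<forall>\<^sub>F E in at 0. E \<in> I \<and> K * \<bar>E\<bar> \<le> 1 / 2 \<and>
    (\<forall>t\<in>{0..1}. \<bar>h E t - 1\<bar> \<le> K * \<bar>E\<bar> \<and> \<bar>h' E t\<bar> \<le> K * \<bar>E\<bar> \<and> \<bar>h'' E t\<bar> \<le> K * \<bar>E\<bar>)"
    by (rule near_flat_bounds)
  show thesis
  proof (rule that[of "16 * K"], rule eventually_mono[OF K(2)], intro ballI)
    fix E t :: real
    assume *: "E \<in> I \<and> K * \<bar>E\<bar> \<le> 1 / 2 \<and>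
      (\<forall>t\<in>{0..1}. \<bar>h E t - 1\<bar> \<le> K * \<bar>E\<bar> \<and> \<bar>h' E t\<bar> \<le> K * \<bar>E\<bar> \<and> \<bar>h'' E t\<bar> \<le> K * \<bar>E\<bar>)"
      and t: "t \<in> {0..1}"
    have b: "\<bar>h E t - 1\<bar> \<le> K * \<bar>E\<bar>" using * t by blast
    then have h: "0 \<le> h E t" "h E t \<le> 3 / 2" using * by linarith+
    have "(h E t)\<^sup>2 \<le> (3 / 2)\<^sup>2" using h by (intro power_mono) auto
    \<comment> \<open>For \<open>h E t \<le> 3 / 2\<close> the factors are at most 5/2 and 13/4;
      rounding both up to 4 gives the constant 16.\<close>
    then have "(h E t + 1) * ((h E t)\<^sup>2 + 1) \<le> 4 * 4"
      using h by (intro mult_mono) (auto simp: power2_eq_square)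
    then have c: "\<bar>(h E t + 1) * ((h E t)\<^sup>2 + 1)\<bar> \<le> 16" using h by simp
    have "h E t ^ 4 - 1 = (h E t - 1) * ((h E t + 1) * ((h E t)\<^sup>2 + 1))"
      by (simp add: algebra_simps power2_eq_square power4_eq_xxxx)
    then have "\<bar>h E t ^ 4 - 1\<bar> \<le> (K * \<bar>E\<bar>) * 16"
      unfolding \<open>h E t ^ 4 - 1 = _\<close> abs_mult[of "h E t - 1"] using b c by (intro mult_mono) auto
    then show "\<bar>h E t ^ 4 - 1\<bar> \<le> 16 * K * \<bar>E\<bar>" by simp
  qed
qed

end

section \<open>Expansions at 0, real eigenfunctions of a branch, and the flat solutions\<close>

lemma eventually_Lipschitz_at_0:
  fixes f :: "real \<Rightarrow> real"
  assumes "(f has_real_derivative D) (at 0)"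
  shows "\<forall>\<^sub>F E in at 0. \<bar>f E - f 0\<bar> \<le> (\<bar>D\<bar> + 1) * \<bar>E\<bar>"
proof -
  have "((\<lambda>E. \<bar>(f E - f 0) / E\<bar>) \<longlongrightarrow> \<bar>D\<bar>) (at 0)"
    using assms unfolding has_field_derivative_iff by (intro tendsto_rabs) simp
  then have "\<forall>\<^sub>F E in at 0. \<bar>(f E - f 0) / E\<bar> < \<bar>D\<bar> + 1"
    by (intro order_tendstoD) auto
  moreover have "\<forall>\<^sub>F E in at (0::real). E \<noteq> 0" by (simp add: eventually_at_filter)
  ultimately show ?thesis
    by eventually_elim (simp add: field_simps)
qed

lemma second_order_expansion_tendsto:
  fixes f :: "real \<Rightarrow> real"
  assumes "(\<lambda>E. f E - (1 + E * u + E\<^sup>2 * v)) \<in> O[at 0](\<lambda>E. E ^ 3)"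
  shows "((\<lambda>E. (f E - 1) / E) \<longlongrightarrow> u) (at 0)"
proof -
  obtain c where c: "\<forall>\<^sub>F E in at 0. norm (f E - (1 + E * u + E\<^sup>2 * v)) \<le> c * norm (E ^ 3)"
    using landau_o.bigE[OF assms] by blast
  have ne: "\<forall>\<^sub>F E in at (0::real). E \<noteq> 0" by (simp add: eventually_at_filter)
  have "((\<lambda>E. (f E - (1 + E * u + E\<^sup>2 * v)) / E) \<longlongrightarrow> 0) (at 0)"
  proof (rule Lim_null_comparison)
    show "\<forall>\<^sub>F E in at 0. norm ((f E - (1 + E * u + E\<^sup>2 * v)) / E) \<le> c * E\<^sup>2"
      using c ne
    proof eventually_elim
      case (elim E)
      have "norm (E ^ 3) = E\<^sup>2 * \<bar>E\<bar>" by (simp add: abs_mult power3_eq_cube power2_eq_square)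
      then show ?case using elim by (simp add: pos_divide_le_eq mult.assoc)
    qed
    have "((\<lambda>E::real. c * E\<^sup>2) \<longlongrightarrow> c * 0\<^sup>2) (at 0)" by (intro tendsto_intros)
    then show "((\<lambda>E::real. c * E\<^sup>2) \<longlongrightarrow> 0) (at 0)" by simp
  qed
  then have "((\<lambda>E. u + E * v + (f E - (1 + E * u + E\<^sup>2 * v)) / E) \<longlongrightarrow> u + 0 * v + 0) (at 0)"
    by (intro tendsto_intros)
  moreover have "\<forall>\<^sub>F E in at 0. u + E * v + (f E - (1 + E * u + E\<^sup>2 * v)) / E = (f E - 1) / E"
    using ne by eventually_elim (simp add: divide_simps power2_eq_square, simp add: algebra_simps)
  ultimately show ?thesis using tendsto_cong by fastforce
qed

text \<open>Joint smoothness of the eigenfunctions gives uniform convergence as \<open>E\<close>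
  tends to 0. The limit \<open>\<phi>\<close> is real, so taking real parts does not change
  it.\<close>

lemma spectral_branch_hill_solution:
  assumes A: "spectral_branch I Q \<nu> A" and A0: "\<And>t. A 0 t = complex_of_real (\<phi> t)"
    and I: "open I" "0 \<in> I"
  obtains a a' where "\<And>E. E \<in> I \<Longrightarrow> hill_solution (Q E (\<nu> E)) (a E) (a' E)"
    "uniform_limit {0..1} a \<phi> (at 0)"
proof -
  have "\<exists>a'. hill_solution (Q E (\<nu> E)) (\<lambda>t. Re (A E t)) a'" if "E \<in> I" for E
    using A that periodic_solutions_Re_Im[of "A E" "Q E (\<nu> E)"] unfolding spectral_branch_def by metis
  then obtain a' where a': "\<And>E. E \<in> I \<Longrightarrow> hill_solution (Q E (\<nu> E)) (\<lambda>t. Re (A E t)) (a' E)"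
    by metis
  have "uniform_limit {0..1} (\<lambda>E t. A E t) (A 0) (at 0)"
    using A smooth_on_uniform_limit[of I "\<lambda>(E, t). A E t"] I by (simp add: spectral_branch_def)
  then have "uniform_limit {0..1} (\<lambda>E t. Re (A E t)) (\<lambda>t. Re (A 0 t)) (at 0)"
    by (rule bounded_linear.uniform_limit[OF bounded_linear_Re])
  then show thesis using a' by (intro that[of "\<lambda>E t. Re (A E t)" a']) (simp_all add: A0)
qed

lemma spectral_branch_differentiable:
  assumes "spectral_branch I Q \<nu> A" "0 \<in> I"
  shows "\<exists>D. (\<nu> has_real_derivative D) (at 0)"
  using assms smooth_on_has_derivative[of I \<nu> 0] unfolding spectral_branch_def
  by (meson differentiableI real_differentiable_def)

lemma hill_solution_sin: "hill_solution (\<lambda>_. 4 * pi\<^sup>2) (\<lambda>t. sin (2 * pi * t)) (\<lambda>t. 2 * pi * cos (2 * pi * t))"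
  and hill_solution_cos: "hill_solution (\<lambda>_. 4 * pi\<^sup>2) (\<lambda>t. cos (2 * pi * t)) (\<lambda>t. - 2 * pi * sin (2 * pi * t))"
  and hill_solution_const: "hill_solution (\<lambda>_. 0) (\<lambda>_. 1) (\<lambda>_. 0)"
  unfolding hill_solution_def
  by (auto intro!: derivative_eq_intros simp: distrib_left power2_eq_square sin_add cos_add)

lemma has_integral_sin_squared: "((\<lambda>t. sin (2 * pi * t) * sin (2 * pi * t)) has_integral 1 / 2) {0..1}"
  and has_integral_cos_squared: "((\<lambda>t. cos (2 * pi * t) * cos (2 * pi * t)) has_integral 1 / 2) {0..1}"
proof -
  \<comment> \<open>The periodic part of an antiderivative of \<open>sin^2\<close>: its derivative
    is \<open>sin^2 - 1 / 2\<close>.\<close>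
  let ?F = "\<lambda>t::real. - (sin (2 * pi * t) * cos (2 * pi * t) / (4 * pi))"
  have *: "((\<lambda>t. sin (2 * pi * t) * sin (2 * pi * t) - 1 / 2) has_integral 0) {0..1}"
  proof (rule has_integral_periodic_derivative[of ?F])
    fix t :: real
    have "((\<lambda>t. - (sin (2 * pi * t) * cos (2 * pi * t) / (4 * pi))) has_real_derivative
        ((sin (2 * pi * t))\<^sup>2 - (cos (2 * pi * t))\<^sup>2) / 2) (at t)"
      by (auto intro!: derivative_eq_intros simp: field_simps power2_eq_square)
    moreover have "((sin (2 * pi * t))\<^sup>2 - (cos (2 * pi * t))\<^sup>2) / 2 = sin (2 * pi * t) * sin (2 * pi * t) - 1 / 2"
      unfolding cos_squared_eq by (simp add: power2_eq_square)
    ultimately show "(?F has_real_derivative sin (2 * pi * t) * sin (2 * pi * t) - 1 / 2) (at t)"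
      by simp
  qed (simp add: distrib_left sin_add cos_add)
  have one: "((\<lambda>_. 1 / 2 :: real) has_integral 1 / 2) {0..1::real}"
    using has_integral_const_real[of "1 / 2 :: real" 0 1] by simp
  show s: "((\<lambda>t. sin (2 * pi * t) * sin (2 * pi * t)) has_integral 1 / 2) {0..1}"
    using has_integral_add[OF * one] by simp
  have "((\<lambda>t. 1 / 2 + 1 / 2 - sin (2 * pi * t) * sin (2 * pi * t)) has_integral 1 / 2 + 1 / 2 - 1 / 2) {0..1}"
    by (intro has_integral_add has_integral_diff one s)
  then show "((\<lambda>t. cos (2 * pi * t) * cos (2 * pi * t)) has_integral 1 / 2) {0..1}"
    by (simp add: cos_squared_eq flip: power2_eq_square)
qed

section \<open>First-order conditions along a branch, and the Laplace eigenvalues\<close>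

context torus_deformation
begin

lemma coefficient_bound:
  assumes \<nu>: "(\<nu> has_real_derivative D) (at 0)" "\<nu> 0 = c"
    and s: "\<forall>\<^sub>F E in at 0. \<forall>t\<in>{0..1}. \<bar>s E t\<bar> \<le> K * \<bar>E\<bar>"
  obtains M where "\<forall>\<^sub>F E in at 0. \<forall>t\<in>{0..1}. \<bar>\<nu> E * h E t ^ 4 + s E t - c\<bar> \<le> M * \<bar>E\<bar>"
proof -
  obtain L where L: "\<forall>\<^sub>F E in at 0. \<forall>t\<in>{0..1}. \<bar>h E t ^ 4 - 1\<bar> \<le> L * \<bar>E\<bar>"
    by (rule h_pow4_bound)
  have "\<nu> \<midarrow>0\<rightarrow> c"
    using DERIV_isCont[OF \<nu>(1)] \<nu>(2) by (simp add: isCont_def)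
  then have "((\<lambda>E. \<bar>\<nu> E\<bar>) \<longlongrightarrow> \<bar>c\<bar>) (at 0)"
    by (rule tendsto_rabs)
  then have "\<forall>\<^sub>F E in at 0. \<bar>\<nu> E\<bar> < \<bar>c\<bar> + 1"
    by (intro order_tendstoD) auto
  then have "\<forall>\<^sub>F E in at 0. \<forall>t\<in>{0..1}. \<bar>\<nu> E * h E t ^ 4 + s E t - c\<bar> \<le>
      ((\<bar>c\<bar> + 1) * L + (\<bar>D\<bar> + 1) + K) * \<bar>E\<bar>"
    using L s eventually_Lipschitz_at_0[OF \<nu>(1)]
  proof eventually_elim
    case (elim E)
    show ?case
    proof
      fix t :: real assume t: "t \<in> {0..1}"
      have "\<bar>\<nu> E * (h E t ^ 4 - 1)\<bar> \<le> (\<bar>c\<bar> + 1) * (L * \<bar>E\<bar>)"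
        unfolding abs_mult using elim(1,2) t by (intro mult_mono) auto
      moreover have "\<bar>s E t\<bar> \<le> K * \<bar>E\<bar>" using elim(3) t by blast
      \<comment> \<open>The deviation from \<open>c\<close> has three sources, each of order
        \<open>E\<close>: the metric, the perturbation \<open>s\<close>, and the motion of the
        eigenvalue.\<close>
      moreover have "\<nu> E * h E t ^ 4 + s E t - c = \<nu> E * (h E t ^ 4 - 1) + s E t + (\<nu> E - \<nu> 0)"
        by (simp add: \<nu>(2) algebra_simps)
      ultimately have "\<bar>\<nu> E * h E t ^ 4 + s E t - c\<bar> \<le>
          (\<bar>c\<bar> + 1) * (L * \<bar>E\<bar>) + K * \<bar>E\<bar> + (\<bar>D\<bar> + 1) * \<bar>E\<bar>"
        using elim(4) by (simp only:) (smt (verit))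
      then show "\<bar>\<nu> E * h E t ^ 4 + s E t - c\<bar> \<le> ((\<bar>c\<bar> + 1) * L + (\<bar>D\<bar> + 1) + K) * \<bar>E\<bar>"
        by (simp add: distrib_right mult.assoc)
    qed
  qed
  then show thesis by (rule that)
qed

text \<open>The constant \<open>d\<close> holds the term \<open>- 4 pi^2 k^2\<close> or
  \<open>- 4 pi^2 l^2\<close>, which is independent of \<open>E\<close> and cancels against the flat
  coefficient \<open>c + d\<close>. The flat solution \<open>b\<close> is both the limit of the
  branch and the test function, hence the weight \<open>b t * b t\<close>.\<close>

lemma branch_first_order:
  assumes \<nu>: "(\<nu> has_real_derivative D) (at 0)" "\<nu> 0 = c"
    and s_cont: "\<And>E. E \<in> I \<Longrightarrow> continuous_on {0..1} (s E)"
    and s: "\<forall>\<^sub>F E in at 0. \<forall>t\<in>{0..1}. \<bar>s E t\<bar> \<le> K * \<bar>E\<bar>"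
    and sol: "\<And>E. E \<in> I \<Longrightarrow> hill_solution (\<lambda>t. \<nu> E * h E t ^ 4 + s E t + d) (a E) (a' E)"
    and b: "hill_solution (\<lambda>_. c + d) b b'"
    and lim: "uniform_limit {0..1} a b (at 0)"
  shows "((\<lambda>E. integral {0..1} (\<lambda>t. (\<nu> E * h E t ^ 4 + s E t - c) / E * (b t * b t))) \<longlongrightarrow> 0) (at 0)"
proof -
  obtain M where M: "\<forall>\<^sub>F E in at 0. \<forall>t\<in>{0..1}. \<bar>\<nu> E * h E t ^ 4 + s E t - c\<bar> \<le> M * \<bar>E\<bar>"
    by (rule coefficient_bound[OF \<nu> s])
  have "((\<lambda>E. integral {0..1} (\<lambda>t. ((\<nu> E * h E t ^ 4 + s E t + d) - (c + d)) / E * (b t * b t))) \<longlongrightarrow> 0) (at 0)"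
  proof (rule hill_solution_first_order[OF _ b _ _ lim hill_solution_continuous[OF b]])
    show "\<forall>\<^sub>F E in at 0. hill_solution (\<lambda>t. \<nu> E * h E t ^ 4 + s E t + d) (a E) (a' E)"
      using eventually_in_I by eventually_elim (rule sol)
    show "\<forall>\<^sub>F E in at 0. \<forall>t\<in>{0..1}. \<bar>\<nu> E * h E t ^ 4 + s E t + d - (c + d)\<bar> \<le> M * \<bar>E\<bar>"
      using M by (simp add: algebra_simps)
    show "\<forall>\<^sub>F E in at 0. continuous_on {0..1} (\<lambda>t. \<nu> E * h E t ^ 4 + s E t + d)"
      using eventually_in_I by eventually_elim (intro continuous_intros continuous_h s_cont)
  qed
  then show ?thesis by simp
qed

lemma branch_has_real_derivative:
  assumes \<nu>: "(\<nu> has_real_derivative D) (at 0)" "\<nu> 0 = c"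
    and s_cont: "\<And>E. E \<in> I \<Longrightarrow> continuous_on {0..1} (s E)"
    and \<phi>: "continuous_on {0..1} \<phi>" "(\<phi> has_integral J) {0..1}" "J \<noteq> 0"
    and H: "\<And>t. ((\<lambda>E. (h E t ^ 4 - 1) / E) \<longlongrightarrow> H t) (at 0)"
    and s_lim: "((\<lambda>E. integral {0..1} (\<lambda>t. s E t / E * \<phi> t)) \<longlongrightarrow> 0) (at 0)"
    and first_order: "((\<lambda>E. integral {0..1} (\<lambda>t. (\<nu> E * h E t ^ 4 + s E t - c) / E * \<phi> t)) \<longlongrightarrow> 0) (at 0)"
  shows "(\<lambda>t. H t * \<phi> t) integrable_on {0..1}"
    "(\<nu> has_real_derivative - c * integral {0..1} (\<lambda>t. H t * \<phi> t) / J) (at 0)"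
proof -
  obtain K where K: "\<forall>\<^sub>F E in at 0. \<forall>t\<in>{0..1}. \<bar>h E t ^ 4 - 1\<bar> \<le> K * \<bar>E\<bar>"
    by (rule h_pow4_bound)
  have p: "\<forall>\<^sub>F E in at 0. continuous_on {0..1} (\<lambda>t. h E t ^ 4)"
    using eventually_in_I by eventually_elim (intro continuous_intros continuous_h)
  have s: "\<forall>\<^sub>F E in at 0. continuous_on {0..1} (s E)"
    using eventually_in_I by eventually_elim (rule s_cont)
  note main = eigenvalue_has_real_derivative[where p = "\<lambda>E t. h E t ^ 4",
      OF \<nu>(2) p s \<phi>(1) K H s_lim first_order \<phi>(2,3)]
  show "(\<lambda>t. H t * \<phi> t) integrable_on {0..1}" by (rule main(1))
  show "(\<nu> has_real_derivative - c * integral {0..1} (\<lambda>t. H t * \<phi> t) / J) (at 0)" by (rule main(2))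
qed

text \<open>The flat eigenfunction is tested against itself, with no perturbation \<open>s\<close>.
  The squared norm \<open>J\<close> is 1/2 for sine and cosine, which turns \<open>4 * pi^2\<close>
  into \<open>8 * pi^2\<close>, and 1 for the constant function.\<close>

lemma laplace_branch_has_real_derivative:
  assumes branch: "deformation_branch I (\<lambda>E. laplace_coeff (h E) k) \<phi> \<mu>"
    and H: "\<And>t. ((\<lambda>E. (h E t ^ 4 - 1) / E) \<longlongrightarrow> H t) (at 0)"
    and \<phi>: "hill_solution (\<lambda>_. 4 * pi\<^sup>2 - 4 * pi\<^sup>2 * (of_int k)\<^sup>2) \<phi> \<phi>'"
    and J: "((\<lambda>t. \<phi> t * \<phi> t) has_integral J) {0..1}" "J \<noteq> 0"
  shows "(\<lambda>t. H t * (\<phi> t * \<phi> t)) integrable_on {0..1}"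
    "(\<mu> has_real_derivative - (4 * pi\<^sup>2) * integral {0..1} (\<lambda>t. H t * (\<phi> t * \<phi> t)) / J) (at 0)"
proof -
  obtain A where A: "spectral_branch I (\<lambda>E. laplace_coeff (h E) k) \<mu> A"
    "\<And>t. A 0 t = complex_of_real (\<phi> t)"
    using branch by (auto simp: deformation_branch_def)
  have \<mu>0: "\<mu> 0 = 4 * pi\<^sup>2" using A(1) by (simp add: spectral_branch_def)
  obtain D where D: "(\<mu> has_real_derivative D) (at 0)"
    using spectral_branch_differentiable[OF A(1) I(2)] by blast
  obtain a a' where a: "\<And>E. E \<in> I \<Longrightarrow> hill_solution (laplace_coeff (h E) k (\<mu> E)) (a E) (a' E)"
    "uniform_limit {0..1} a \<phi> (at 0)"
    using spectral_branch_hill_solution[OF A I] by blast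
  have sol: "hill_solution (\<lambda>t. \<mu> E * h E t ^ 4 + 0 + - (4 * pi\<^sup>2 * (of_int k)\<^sup>2)) (a E) (a' E)"
    if "E \<in> I" for E
    using a(1)[OF that] by (simp add: laplace_coeff_def[abs_def])
  have first_order: "((\<lambda>E. integral {0..1} (\<lambda>t. (\<mu> E * h E t ^ 4 + 0 - 4 * pi\<^sup>2) / E * (\<phi> t * \<phi> t))) \<longlongrightarrow> 0) (at 0)"
    by (rule branch_first_order[OF D \<mu>0 _ _ sol _ a(2), where K = 0 and b' = \<phi>']) (use \<phi> in simp_all)
  have cont: "continuous_on {0..1} (\<lambda>t. \<phi> t * \<phi> t)"
    by (intro continuous_intros hill_solution_continuous[OF \<phi>])
  note main = branch_has_real_derivative[where s = "\<lambda>_ _. 0", OF D \<mu>0 _ cont J H _ first_order]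
  show "(\<lambda>t. H t * (\<phi> t * \<phi> t)) integrable_on {0..1}" by (rule main(1)) simp_all
  show "(\<mu> has_real_derivative - (4 * pi\<^sup>2) * integral {0..1} (\<lambda>t. H t * (\<phi> t * \<phi> t)) / J) (at 0)"
    by (rule main(2)) simp_all
qed

section \<open>The spin term of the Dirac equation\<close>

text \<open>What remains of the Dirac coefficient once the eigenvalue term and
  \<open>- 4 pi^2 l^2\<close> are split off; it vanishes at \<open>E = 0\<close> and acts as the
  perturbation \<open>s\<close>.\<close>

definition spin_term :: "int \<Rightarrow> real \<Rightarrow> real \<Rightarrow> real" where
  "spin_term l E t = (h E t * h'' E t - 2 * (h' E t)\<^sup>2) / (h E t)\<^sup>2 + 4 * pi * of_int l * (h' E t / h E t)"

lemma dirac_coeff_eq: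
  assumes "E \<in> I"
  shows "dirac_coeff (h E) l L = (\<lambda>t. L * h E t ^ 4 + spin_term l E t + - (4 * pi\<^sup>2 * (of_int l)\<^sup>2))"
  by (simp add: fun_eq_iff dirac_coeff_def spin_term_def deriv_h deriv_h' assms)

lemma continuous_spin_term: "E \<in> I \<Longrightarrow> continuous_on S (spin_term l E)"
  unfolding spin_term_def[abs_def]
  by (intro continuous_intros continuous_h continuous_h' continuous_h'')
    (auto simp: less_imp_neq[OF pos, symmetric])

text \<open>With \<open>w = h' / h\<close> the spin term equals \<open>w' - w\<^sup>2 + 4\<pi>l w\<close>, and both \<open>w\<close> and \<open>w'\<close> are
  derivatives of periodic functions.\<close>

lemma has_integral_spin_term:
  assumes E: "E \<in> I"
  shows "((\<lambda>t. spin_term l E t + (h' E t / h E t)\<^sup>2) has_integral 0) {0..1}"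
proof (rule has_integral_periodic_derivative[of "\<lambda>t. h' E t / h E t + 4 * pi * of_int l * ln (h E t)"])
  fix t
  have p: "h E t > 0" by (rule pos[OF E])
  show "((\<lambda>t. h' E t / h E t + 4 * pi * of_int l * ln (h E t)) has_real_derivative
      spin_term l E t + (h' E t / h E t)\<^sup>2) (at t)"
    by (rule derivative_eq_intros has_derivative_h[OF E] has_derivative_h'[OF E] refl p less_imp_neq[OF p, symmetric])+
      (use p in \<open>simp add: spin_term_def divide_simps power2_eq_square; simp add: algebra_simps\<close>)
qed (simp add: periodic periodic' E)

lemma spin_term_bounds:
  obtains K where "\<forall>\<^sub>F E in at 0. E \<in> I \<and> (\<forall>t\<in>{0..1}. \<bar>h' E t / h E t\<bar> \<le> K * \<bar>E\<bar>)"
    "\<forall>\<^sub>F E in at 0. \<forall>t\<in>{0..1}. \<bar>spin_term l E t\<bar> \<le> K * \<bar>E\<bar>"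
proof -
  obtain K where K: "K \<ge> 0" "\<forall>\<^sub>F E in at 0. E \<in> I \<and> K * \<bar>E\<bar> \<le> 1 / 2 \<and>
    (\<forall>t\<in>{0..1}. \<bar>h E t - 1\<bar> \<le> K * \<bar>E\<bar> \<and> \<bar>h' E t\<bar> \<le> K * \<bar>E\<bar> \<and> \<bar>h'' E t\<bar> \<le> K * \<bar>E\<bar>)"
    by (rule near_flat_bounds)
  \<comment> \<open>With \<open>\<epsilon> = K * \<bar>E\<bar>\<close> the spin term collects
    \<open>2 * \<epsilon>\<close> from \<open>h'' / h\<close>, \<open>4 * \<epsilon>\<close> from
    \<open>2 * (h' / h)^2\<close> and \<open>8 * pi * \<bar>l\<bar> * \<epsilon>\<close> from the
    term with \<open>l\<close>: in sum \<open>(C + 2) * \<epsilon>\<close>.\<close>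
  define C where "C = 4 + 8 * pi * \<bar>of_int l\<bar>"
  have C: "C \<ge> 4" unfolding C_def by simp
  have *: "\<bar>h' E t / h E t\<bar> \<le> 2 * (K * \<bar>E\<bar>) \<and> \<bar>spin_term l E t\<bar> \<le> (C + 2) * (K * \<bar>E\<bar>)"
    if E: "E \<in> I \<and> K * \<bar>E\<bar> \<le> 1 / 2 \<and>
      (\<forall>t\<in>{0..1}. \<bar>h E t - 1\<bar> \<le> K * \<bar>E\<bar> \<and> \<bar>h' E t\<bar> \<le> K * \<bar>E\<bar> \<and> \<bar>h'' E t\<bar> \<le> K * \<bar>E\<bar>)"
      and t: "t \<in> {0..1}" for E t
  proof -
    define \<epsilon> where "\<epsilon> = K * \<bar>E\<bar>"
    have b: "\<bar>h E t - 1\<bar> \<le> \<epsilon>" "\<bar>h' E t\<bar> \<le> \<epsilon>" "\<bar>h'' E t\<bar> \<le> \<epsilon>" "\<epsilon> \<le> 1 / 2"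
      using E t by (auto simp: \<epsilon>_def)
    have p: "h E t \<ge> 1 / 2" using b by linarith
    have quot: "\<bar>x / h E t\<bar> \<le> 2 * \<epsilon>" if "\<bar>x\<bar> \<le> \<epsilon>" for x
    proof -
      have "\<bar>x / h E t\<bar> \<le> \<epsilon> / (1 / 2)"
        unfolding abs_divide using that p by (intro frac_le) auto
      then show ?thesis by simp
    qed
    have w: "\<bar>h' E t / h E t\<bar> \<le> 2 * \<epsilon>" "\<bar>h'' E t / h E t\<bar> \<le> 2 * \<epsilon>"
      using quot b by blast+
    \<comment> \<open>One factor is bounded by \<open>2 * \<epsilon>\<close> and the other by 1,
      because \<open>\<epsilon> \<le> 1 / 2\<close>.\<close>
    have "(h' E t / h E t)\<^sup>2 \<le> 2 * \<epsilon> * 1"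
      unfolding power2_eq_square using w b
        abs_mult[of "h' E t / h E t" "h' E t / h E t"]
        mult_mono[of "\<bar>h' E t / h E t\<bar>" "2 * \<epsilon>" "\<bar>h' E t / h E t\<bar>" 1] by auto
    moreover have "\<bar>4 * pi * of_int l * (h' E t / h E t)\<bar> \<le> (4 * pi * \<bar>of_int l\<bar>) * (2 * \<epsilon>)"
      using w(1) unfolding abs_mult[of _ "h' E t / h E t"] by (intro mult_mono) (auto simp: abs_mult)
    moreover have "spin_term l E t = h'' E t / h E t - 2 * (h' E t / h E t)\<^sup>2
        + 4 * pi * of_int l * (h' E t / h E t)"
      unfolding spin_term_def using p by (simp add: power2_eq_square diff_divide_distrib)
    ultimately have "\<bar>spin_term l E t\<bar> \<le> 2 * \<epsilon> + 2 * (2 * \<epsilon>) + (4 * pi * \<bar>of_int l\<bar>) * (2 * \<epsilon>)"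
      using w(2) zero_le_power2[of "h' E t / h E t"] unfolding abs_le_iff by argo
    also have "\<dots> = (C + 2) * \<epsilon>" by (simp add: C_def algebra_simps)
    finally show ?thesis using w(1) by (simp add: \<epsilon>_def)
  qed
  show thesis
  proof (rule that[of "(C + 2) * K"])
    show "\<forall>\<^sub>F E in at 0. E \<in> I \<and> (\<forall>t\<in>{0..1}. \<bar>h' E t / h E t\<bar> \<le> (C + 2) * K * \<bar>E\<bar>)"
      using K(2)
    proof eventually_elim
      case (elim E)
      have "2 * (K * \<bar>E\<bar>) \<le> (C + 2) * (K * \<bar>E\<bar>)"
        using C K(1) by (intro mult_right_mono) auto
      then show ?case using *[OF elim] elim by (fastforce simp: mult.assoc)
    qed
    show "\<forall>\<^sub>F E in at 0. \<forall>t\<in>{0..1}. \<bar>spin_term l E t\<bar> \<le> (C + 2) * K * \<bar>E\<bar>"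
      using K(2) by eventually_elim (use * in \<open>simp add: mult.assoc\<close>)
  qed
qed

text \<open>The integral of the spin term is minus that of \<open>(h' / h)^2\<close>, which is at
  most \<open>K^2 * E^2\<close>; after the division one factor \<open>E\<close> is left. The factor
  \<open>1\<close> is the constant weight in the place of \<open>\<phi>\<close>.\<close>

lemma spin_term_integral_tendsto:
  "((\<lambda>E. integral {0..1} (\<lambda>t. spin_term l E t / E * 1)) \<longlongrightarrow> 0) (at 0)"
proof -
  obtain K where K: "\<forall>\<^sub>F E in at 0. E \<in> I \<and> (\<forall>t\<in>{0..1}. \<bar>h' E t / h E t\<bar> \<le> K * \<bar>E\<bar>)"
    "\<forall>\<^sub>F E in at 0. \<forall>t\<in>{0..1}. \<bar>spin_term l E t\<bar> \<le> K * \<bar>E\<bar>"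
    by (rule spin_term_bounds)
  have ne: "\<forall>\<^sub>F E in at (0::real). E \<noteq> 0" by (simp add: eventually_at_filter)
  show ?thesis
  proof (rule Lim_null_comparison)
    show "\<forall>\<^sub>F E in at 0. norm (integral {0..1} (\<lambda>t. spin_term l E t / E * 1)) \<le> K\<^sup>2 * \<bar>E\<bar>"
      using K(1) ne
    proof eventually_elim
      case (elim E)
      then have E: "E \<in> I" by blast
      let ?W = "integral {0..1} (\<lambda>t. (h' E t / h E t)\<^sup>2)"
      have W: "((\<lambda>t. (h' E t / h E t)\<^sup>2) has_integral ?W) {0..1}"
        by (intro integrable_integral integrable_continuous_interval continuous_intros
            continuous_h[OF E] continuous_h'[OF E]) (auto simp: less_imp_neq[OF pos[OF E], symmetric])
      have "norm ?W \<le> (K * \<bar>E\<bar>)\<^sup>2 * measure lborel (cbox 0 (1::real))"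
      proof (rule has_integral_bound)
        show "((\<lambda>t. (h' E t / h E t)\<^sup>2) has_integral ?W) (cbox 0 1)" using W by simp
        fix t :: real assume "t \<in> cbox 0 1"
        then have "\<bar>h' E t / h E t\<bar> \<le> K * \<bar>E\<bar>" using elim by auto
        then have "\<bar>h' E t / h E t\<bar>\<^sup>2 \<le> (K * \<bar>E\<bar>)\<^sup>2" by (intro power_mono) auto
        then show "norm ((h' E t / h E t)\<^sup>2) \<le> (K * \<bar>E\<bar>)\<^sup>2"
          unfolding power2_abs real_norm_def abs_power2 .
      qed simp
      then have W': "\<bar>?W\<bar> \<le> (K * \<bar>E\<bar>)\<^sup>2" by simp
      have "((\<lambda>t. spin_term l E t + (h' E t / h E t)\<^sup>2 - (h' E t / h E t)\<^sup>2) has_integral 0 - ?W) {0..1}"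
        by (intro has_integral_diff has_integral_spin_term[OF E] W)
      then have "((\<lambda>t. spin_term l E t / E) has_integral (- ?W) / E) {0..1}"
        by (intro has_integral_divide) simp
      then have "integral {0..1} (\<lambda>t. spin_term l E t / E * 1) = - ?W / E"
        unfolding mult_1_right by (rule integral_unique)
      then have "norm (integral {0..1} (\<lambda>t. spin_term l E t / E * 1)) = \<bar>?W\<bar> / \<bar>E\<bar>" by simp
      also have "\<dots> \<le> (K * \<bar>E\<bar>)\<^sup>2 / \<bar>E\<bar>" by (intro divide_right_mono W') simp
      also have "\<dots> = K\<^sup>2 * \<bar>E\<bar>" by (simp add: power_mult_distrib power2_eq_square)
      finally show ?case .
    qed
    have "((\<lambda>E::real. K\<^sup>2 * \<bar>E\<bar>) \<longlongrightarrow> K\<^sup>2 * \<bar>0\<bar>) (at 0)" by (intro tendsto_intros)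
    then show "((\<lambda>E::real. K\<^sup>2 * \<bar>E\<bar>) \<longlongrightarrow> 0) (at 0)" by simp
  qed
qed

section \<open>The Dirac eigenvalues\<close>

lemma dirac_first_order_imp_derivative:
  assumes \<nu>: "(\<nu> has_real_derivative D) (at 0)" "\<nu> 0 = c"
    and H: "\<And>t. ((\<lambda>E. (h E t ^ 4 - 1) / E) \<longlongrightarrow> H t) (at 0)"
    and first_order: "((\<lambda>E. integral {0..1} (\<lambda>t. (\<nu> E * h E t ^ 4 + spin_term l E t - c) / E * 1)) \<longlongrightarrow> 0) (at 0)"
  shows "(\<nu> has_real_derivative - c * integral {0..1} H) (at 0)"
proof -
  have one: "((\<lambda>_. 1 :: real) has_integral 1) {0..1::real}"
    using has_integral_const_real[of "1 :: real" 0 1] by simp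
  show ?thesis
    using branch_has_real_derivative(2)[where s = "spin_term l", OF \<nu> continuous_spin_term _ one _ H
        spin_term_integral_tendsto first_order] by simp
qed

text \<open>For \<open>l\<close> of absolute value 1 the flat coefficient
  \<open>4 pi^2 - 4 pi^2 l^2\<close> is 0, and the square of its solution 1 is already the constant
  weight. The sign of \<open>l\<close> affects only \<open>4 pi l h' / h\<close>, which integrates
  to 0 over a period.\<close>

lemma dirac_branch_has_real_derivative:
  assumes branch: "deformation_branch I (\<lambda>E. dirac_coeff (h E) l) (\<lambda>_. 1) \<nu>" and l: "\<bar>l\<bar> = 1"
    and H: "\<And>t. ((\<lambda>E. (h E t ^ 4 - 1) / E) \<longlongrightarrow> H t) (at 0)"
  shows "(\<nu> has_real_derivative - (4 * pi\<^sup>2) * integral {0..1} H) (at 0)"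
proof -
  obtain A where A: "spectral_branch I (\<lambda>E. dirac_coeff (h E) l) \<nu> A"
    "\<And>t. A 0 t = complex_of_real 1"
    using branch by (auto simp: deformation_branch_def)
  have \<nu>0: "\<nu> 0 = 4 * pi\<^sup>2" using A(1) by (simp add: spectral_branch_def)
  obtain D where D: "(\<nu> has_real_derivative D) (at 0)"
    using spectral_branch_differentiable[OF A(1) I(2)] by blast
  obtain a a' where a: "\<And>E. E \<in> I \<Longrightarrow> hill_solution (dirac_coeff (h E) l (\<nu> E)) (a E) (a' E)"
    "uniform_limit {0..1} a (\<lambda>_. 1) (at 0)"
    using spectral_branch_hill_solution[OF A I] by blast
  have sol: "hill_solution (\<lambda>t. \<nu> E * h E t ^ 4 + spin_term l E t + - (4 * pi\<^sup>2 * (of_int l)\<^sup>2)) (a E) (a' E)"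
    if "E \<in> I" for E
    using a(1)[OF that] by (simp add: dirac_coeff_eq that)
  have "(of_int l :: real)\<^sup>2 = 1" using l by (metis of_int_1 of_int_abs power2_abs power_one)
  then have const: "hill_solution (\<lambda>_. 4 * pi\<^sup>2 + - (4 * pi\<^sup>2 * (of_int l)\<^sup>2)) (\<lambda>_. 1) (\<lambda>_. 0)"
    using hill_solution_const by simp
  obtain K where K: "\<forall>\<^sub>F E in at 0. \<forall>t\<in>{0..1}. \<bar>spin_term l E t\<bar> \<le> K * \<bar>E\<bar>"
    by (rule spin_term_bounds)
  show ?thesis
    using branch_first_order[OF D \<nu>0 continuous_spin_term K sol const a(2)]
    by (intro dirac_first_order_imp_derivative[OF D \<nu>0 H]) simp
qed

text \<open>Multiplicity two allows the initial values of \<open>cos\<close> and \<open>sin\<close>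
  to be matched for each \<open>E\<close>. The spin term is eliminated only after the two resulting
  conditions have been added.\<close>

lemma double_dirac_branch_has_real_derivative:
  assumes branch: "spectral_branch I (\<lambda>E. dirac_coeff (h E) 0) \<nu> A"
    and dim: "\<And>E. E \<in> I \<Longrightarrow> solution_dim (dirac_coeff (h E) 0 (\<nu> E)) = 2"
    and H: "\<And>t. ((\<lambda>E. (h E t ^ 4 - 1) / E) \<longlongrightarrow> H t) (at 0)"
  shows "(\<nu> has_real_derivative - (4 * pi\<^sup>2) * integral {0..1} H) (at 0)"
proof -
  have \<nu>0: "\<nu> 0 = 4 * pi\<^sup>2" using branch by (simp add: spectral_branch_def)
  obtain D where D: "(\<nu> has_real_derivative D) (at 0)"
    using spectral_branch_differentiable[OF branch I(2)] by blast
  obtain K where K: "\<forall>\<^sub>F E in at 0. \<forall>t\<in>{0..1}. \<bar>spin_term 0 E t\<bar> \<le> K * \<bar>E\<bar>"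
    by (rule spin_term_bounds)
  let ?Q = "\<lambda>E t. \<nu> E * h E t ^ 4 + spin_term 0 E t"
  have cont: "continuous_on {0..1} (?Q E)" if "E \<in> I" for E
    by (intro continuous_intros continuous_h continuous_spin_term that)
  have dim': "solution_dim (?Q E) = 2" if "E \<in> I" for E
    using dim[OF that] by (simp add: dirac_coeff_eq that)
  have first_order: "((\<lambda>E. integral {0..1} (\<lambda>t. (?Q E t - 4 * pi\<^sup>2) / E * (b t * b t))) \<longlongrightarrow> 0) (at 0)"
    if b: "hill_solution (\<lambda>_. 4 * pi\<^sup>2) b b'" for b b'
  proof -
    have "\<exists>a a'. hill_solution (?Q E) a a' \<and> a 0 = b 0 \<and> a' 0 = b' 0" if E: "E \<in> I" for E
    proof -
      have "compact (?Q E ` {0..1})"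
        by (rule compact_continuous_image[OF cont[OF E]]) simp
      then obtain M where "\<forall>x\<in>?Q E ` {0..1}. norm x \<le> M"
        using compact_imp_bounded bounded_iff by metis
      then have "\<bar>?Q E t\<bar> \<le> M" if "t \<in> {0..1}" for t
        using that by auto
      then show ?thesis by (rule hill_solution_initial_values[OF dim'[OF E]])
    qed
    \<comment> \<open>The solutions are chosen for each \<open>E\<close> separately; their
      convergence rests on sharing the initial values of \<open>b\<close>, not on the smooth family
      \<open>A\<close>.\<close>
    then obtain a a' where a: "\<And>E. E \<in> I \<Longrightarrow> hill_solution (?Q E) (a E) (a' E) \<and> a E 0 = b 0 \<and> a' E 0 = b' 0"
      by metis
    obtain M where "\<forall>\<^sub>F E in at 0. \<forall>t\<in>{0..1}. \<bar>?Q E t - 4 * pi\<^sup>2\<bar> \<le> M * \<bar>E\<bar>"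
      by (rule coefficient_bound[OF D \<nu>0 K])
    then have lim: "uniform_limit {0..1} a b (at 0)"
      using eventually_mono[OF eventually_in_I a] by (intro hill_solution_uniform_limit[OF _ b])
    show ?thesis
      by (rule branch_first_order[OF D \<nu>0 continuous_spin_term K, where d = 0 and a' = a'])
        (use a b lim in simp_all)
  qed
  let ?F = "\<lambda>b E. integral {0..1} (\<lambda>t. (?Q E t - 4 * pi\<^sup>2) / E * (b t * b t))"
  have "((\<lambda>E. ?F (\<lambda>t. cos (2 * pi * t)) E + ?F (\<lambda>t. sin (2 * pi * t)) E) \<longlongrightarrow> 0 + 0) (at 0)"
    by (intro tendsto_add first_order[OF hill_solution_cos] first_order[OF hill_solution_sin])
  moreover have "\<forall>\<^sub>F E in at 0. ?F (\<lambda>t. cos (2 * pi * t)) E + ?F (\<lambda>t. sin (2 * pi * t)) E =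
      integral {0..1} (\<lambda>t. (?Q E t - 4 * pi\<^sup>2) / E * 1)"
  proof -
    have "\<forall>\<^sub>F E in at (0::real). E \<noteq> 0" by (simp add: eventually_at_filter)
    with eventually_in_I show ?thesis
    proof eventually_elim
      case (elim E)
      have int: "(\<lambda>t. (?Q E t - 4 * pi\<^sup>2) / E * (b t * b t)) integrable_on {0..1}"
        if "hill_solution (\<lambda>_. 4 * pi\<^sup>2) b b'" for b b'
        using elim hill_solution_continuous[OF that, of "{0..1}"]
        by (intro integrable_continuous_interval continuous_intros continuous_h continuous_spin_term) auto
      have eq: "(?Q E t - 4 * pi\<^sup>2) / E * (cos (2 * pi * t) * cos (2 * pi * t)) +
          (?Q E t - 4 * pi\<^sup>2) / E * (sin (2 * pi * t) * sin (2 * pi * t)) = (?Q E t - 4 * pi\<^sup>2) / E * 1" for t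
        unfolding distrib_left[symmetric] using sin_cos_squared_add3[of "2 * pi * t"] by simp
      show ?case
        unfolding Henstock_Kurzweil_Integration.integral_add[OF int[OF hill_solution_cos] int[OF hill_solution_sin], symmetric] eq ..
    qed
  qed
  ultimately have "((\<lambda>E. integral {0..1} (\<lambda>t. (?Q E t - 4 * pi\<^sup>2) / E * 1)) \<longlongrightarrow> 0) (at 0)"
    using tendsto_cong by force
  then show ?thesis by (rule dirac_first_order_imp_derivative[OF D \<nu>0 H])
qed

end

theorem theorem1:
  fixes I :: "real set" and h :: "real \<Rightarrow> real \<Rightarrow> real" and H G :: "real \<Rightarrow> real"
    and \<mu>1 \<mu>2 \<mu>3 \<Lambda>1 \<Lambda>2 \<Lambda>3 :: "real \<Rightarrow> real"
  assumes deformation: "flat_deformation I h"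
    and expansion: "\<And>t. (\<lambda>E. h E t ^ 4 - (1 + E * H t + E\<^sup>2 * G t)) \<in> O[at 0](\<lambda>E. E ^ 3)"
    and symmetry: "\<And>E t. E \<in> I \<Longrightarrow> h E t ^ 4 = h E (1 - t) ^ 4"
    and mu1: "deformation_branch I (\<lambda>E. laplace_coeff (h E) 0) (\<lambda>t. sin (2 * pi * t)) \<mu>1"
    and mu2: "deformation_branch I (\<lambda>E. laplace_coeff (h E) 0) (\<lambda>t. cos (2 * pi * t)) \<mu>2"
    and mu3: "\<And>k. k \<in> {1, -1} \<Longrightarrow> deformation_branch I (\<lambda>E. laplace_coeff (h E) k) (\<lambda>t. 1) \<mu>3"
    and lambda1: "\<exists>A. spectral_branch I (\<lambda>E. dirac_coeff (h E) 0) \<Lambda>1 A"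
    and lambda1_mult: "\<And>E. E \<in> I \<Longrightarrow> solution_dim (dirac_coeff (h E) 0 (\<Lambda>1 E)) = 2"
    and lambda2: "deformation_branch I (\<lambda>E. dirac_coeff (h E) (-1)) (\<lambda>t. 1) \<Lambda>2"
    and lambda3: "deformation_branch I (\<lambda>E. dirac_coeff (h E) 1) (\<lambda>t. 1) \<Lambda>3"
    and simple: "\<And>E. E \<in> I \<Longrightarrow> E \<noteq> 0 \<Longrightarrow>
                   \<mu>1 E \<noteq> \<mu>2 E \<and>
                   solution_dim (laplace_coeff (h E) 0 (\<mu>1 E)) = 1 \<and>
                   solution_dim (laplace_coeff (h E) 0 (\<mu>2 E)) = 1"
  shows
    "(\<mu>1 has_real_derivative - 8 * pi\<^sup>2 * integral {0..1} (\<lambda>t. H t * (sin (2 * pi * t))\<^sup>2)) (at 0) \<and>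
     (\<mu>2 has_real_derivative - 8 * pi\<^sup>2 * integral {0..1} (\<lambda>t. H t * (cos (2 * pi * t))\<^sup>2)) (at 0) \<and>
     (\<mu>3 has_real_derivative - 4 * pi\<^sup>2 * integral {0..1} H) (at 0) \<and>
     (\<forall>\<Lambda>\<in>{\<Lambda>1, \<Lambda>2, \<Lambda>3}. (\<Lambda> has_real_derivative - 4 * pi\<^sup>2 * integral {0..1} H) (at 0)) \<and>
     deriv \<mu>1 0 + deriv \<mu>2 0 = 2 * deriv \<mu>3 0 \<and>
     (\<forall>\<Lambda>\<in>{\<Lambda>1, \<Lambda>2, \<Lambda>3}. 2 * deriv \<mu>3 0 = 2 * deriv \<Lambda> 0)"
proof -
  interpret torus_deformation I h
    by unfold_locales (rule deformation)
  have H: "((\<lambda>E. (h E t ^ 4 - 1) / E) \<longlongrightarrow> H t) (at 0)" for t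
    by (rule second_order_expansion_tendsto[OF expansion])
  have one: "((\<lambda>_. 1 * 1 :: real) has_integral 1) {0..1::real}"
    using has_integral_const_real[of "1 :: real" 0 1] by simp
  have m1: "(\<mu>1 has_real_derivative - 8 * pi\<^sup>2 * integral {0..1} (\<lambda>t. H t * (sin (2 * pi * t))\<^sup>2)) (at 0)"
    and int1: "(\<lambda>t. H t * (sin (2 * pi * t))\<^sup>2) integrable_on {0..1}"
    using laplace_branch_has_real_derivative[OF mu1 H _ has_integral_sin_squared] hill_solution_sin
    by (simp_all add: power2_eq_square mult.assoc)
  have m2: "(\<mu>2 has_real_derivative - 8 * pi\<^sup>2 * integral {0..1} (\<lambda>t. H t * (cos (2 * pi * t))\<^sup>2)) (at 0)"
    and int2: "(\<lambda>t. H t * (cos (2 * pi * t))\<^sup>2) integrable_on {0..1}"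
    using laplace_branch_has_real_derivative[OF mu2 H _ has_integral_cos_squared] hill_solution_cos
    by (simp_all add: power2_eq_square mult.assoc)
  \<comment> \<open>For \<open>k = 1\<close> the flat coefficient is 0, so the constant function is
    a flat solution, with \<open>J = 1\<close>.\<close>
  have m3: "(\<mu>3 has_real_derivative - 4 * pi\<^sup>2 * integral {0..1} H) (at 0)"
    using laplace_branch_has_real_derivative(2)[OF mu3[of 1] H _ one] hill_solution_const by simp
  obtain A where "spectral_branch I (\<lambda>E. dirac_coeff (h E) 0) \<Lambda>1 A" using lambda1 by blast
  then have l1: "(\<Lambda>1 has_real_derivative - 4 * pi\<^sup>2 * integral {0..1} H) (at 0)"
    using double_dirac_branch_has_real_derivative[OF _ lambda1_mult H] by simp
  have l2: "(\<Lambda>2 has_real_derivative - 4 * pi\<^sup>2 * integral {0..1} H) (at 0)"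
    using dirac_branch_has_real_derivative[OF lambda2 _ H] by simp
  have l3: "(\<Lambda>3 has_real_derivative - 4 * pi\<^sup>2 * integral {0..1} H) (at 0)"
    using dirac_branch_has_real_derivative[OF lambda3 _ H] by simp
  \<comment> \<open>Splitting this integral requires both summands to be integrable; dominated
    convergence supplied this as \<open>int1\<close> and \<open>int2\<close>.\<close>
  have "integral {0..1} H = integral {0..1} (\<lambda>t. H t * (sin (2 * pi * t))\<^sup>2 + H t * (cos (2 * pi * t))\<^sup>2)"
    by (simp flip: distrib_left)
  also have "\<dots> = integral {0..1} (\<lambda>t. H t * (sin (2 * pi * t))\<^sup>2) + integral {0..1} (\<lambda>t. H t * (cos (2 * pi * t))\<^sup>2)"
    by (rule Henstock_Kurzweil_Integration.integral_add[OF int1 int2])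
  finally have "deriv \<mu>1 0 + deriv \<mu>2 0 = 2 * deriv \<mu>3 0"
    unfolding m1[THEN DERIV_imp_deriv] m2[THEN DERIV_imp_deriv] m3[THEN DERIV_imp_deriv]
    by (simp add: algebra_simps)
  then show ?thesis
    using m1 m2 m3 l1 l2 l3 m3[THEN DERIV_imp_deriv] l1[THEN DERIV_imp_deriv]
      l2[THEN DERIV_imp_deriv] l3[THEN DERIV_imp_deriv] by auto
qed

end
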